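(* Let $\mathbb{K}$ be a field, let $R$ be a field that is an associative commutative $\mathbb{K}$-algebra, let $L$ be a Lie algebra over $\mathbb{K}$, let $\varphi: L \rightarrow \mathrm{Der}_{\mathbb{K}}R$ be an injective homomorphism of Lie algebras, and let $M=R\varphi(L)$ be a vector space of dimension $k$ over $R$. Then $\widetilde{L}$ is a subalgebra of the $R$-Lie algebra $R \otimes L$ of codimension $k$ (over $R$).
   Context: Tensor products are over $\mathbb{K}$. $\mathrm{Der}_{\mathbb{K}}R$ is the Lie algebra of $\mathbb{K}$-derivations of $R$, which is also an $R$-module; $R\varphi(L)$ is the $R$-linear span of $\varphi(L)$, and it is closed under the Lie bracket. For an $R$-submodule $M\subset \mathrm{Der}_{\mathbb{K}}R$ closed under the Lie bracket, $\mathfrak{D}=\mathfrak{D}(L,R,M)$ denotes the semidirect product of $M$ and $R\otimes L$: as an $R$-module $\mathfrak{D}=M\oplus (R\otimes L)$, $M$ and $R\otimes L$ are Lie subalgebras (the latter with bracket $[r\otimes l,s\otimes l']=rs\otimes[l,l']$), and $[D, r\otimes l]=D(r)\otimes l$ for $D\in M$, $r\in R$, $l\in L$. Let $\varphi': L\to\mathfrak{D}$ be the monomorphism $\varphi'(l)=\varphi(l)+1\otimes l$, and let $R\varphi'(L)$ be the $R$-linear span of $\varphi'(L)$ in $\mathfrak{D}$. Then $\widetilde{L}:=R\varphi'(L)\cap (R\otimes L)$. *)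

theory Defs
  imports "Jordan_Normal_Form.Missing_VectorSpace" "HOL-Algebra.AbelCoset"
begin

text \<open>
  HOL-Algebra's module records extend ring records.  In a Lie algebra the field
  \<^const>\<open>mult\<close> holds the Lie bracket; \<^const>\<open>one\<close> carries no meaning.  In a plain module
  neither field carries meaning.
\<close>

abbreviation (input) bracket :: "('a, 'm) ring_scheme \<Rightarrow> 'a \<Rightarrow> 'a \<Rightarrow> 'a" where
  "bracket L \<equiv> mult L"

locale lie_algebra = vectorspace K L for K and L +
  assumes bracket_closed:
      "\<lbrakk>x \<in> carrier L; y \<in> carrier L\<rbrakk> \<Longrightarrow> bracket L x y \<in> carrier L"
    and bracket_add_left:
      "\<lbrakk>x \<in> carrier L; y \<in> carrier L; z \<in> carrier L\<rbrakk>
        \<Longrightarrow> bracket L (x \<oplus>\<^bsub>L\<^esub> y) z = bracket L x z \<oplus>\<^bsub>L\<^esub> bracket L y z"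
    and bracket_add_right:
      "\<lbrakk>x \<in> carrier L; y \<in> carrier L; z \<in> carrier L\<rbrakk>
        \<Longrightarrow> bracket L x (y \<oplus>\<^bsub>L\<^esub> z) = bracket L x y \<oplus>\<^bsub>L\<^esub> bracket L x z"
    and bracket_smult_left:
      "\<lbrakk>a \<in> carrier K; x \<in> carrier L; y \<in> carrier L\<rbrakk>
        \<Longrightarrow> bracket L (a \<odot>\<^bsub>L\<^esub> x) y = a \<odot>\<^bsub>L\<^esub> bracket L x y"
    and bracket_smult_right:
      "\<lbrakk>a \<in> carrier K; x \<in> carrier L; y \<in> carrier L\<rbrakk>
        \<Longrightarrow> bracket L x (a \<odot>\<^bsub>L\<^esub> y) = a \<odot>\<^bsub>L\<^esub> bracket L x y"
    and bracket_self: "x \<in> carrier L \<Longrightarrow> bracket L x x = \<zero>\<^bsub>L\<^esub>"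
    and jacobi:
      "\<lbrakk>x \<in> carrier L; y \<in> carrier L; z \<in> carrier L\<rbrakk>
        \<Longrightarrow> bracket L x (bracket L y z) \<oplus>\<^bsub>L\<^esub> bracket L y (bracket L z x)
              \<oplus>\<^bsub>L\<^esub> bracket L z (bracket L x y) = \<zero>\<^bsub>L\<^esub>"

definition lie_subalgebra ::
  "('k, 'm) ring_scheme \<Rightarrow> 'l set \<Rightarrow> ('k, 'l, 'n) module_scheme \<Rightarrow> bool" where
  "lie_subalgebra K W L \<longleftrightarrow>
     lie_algebra K L \<and> subspace K W L \<and> (\<forall>x\<in>W. \<forall>y\<in>W. bracket L x y \<in> W)"

definition lie_hom ::
  "('k, 'm) ring_scheme \<Rightarrow> ('k, 'l, 'n) module_scheme \<Rightarrow> ('k, 'h, 'p) module_scheme \<Rightarrow> ('l \<Rightarrow> 'h) set" where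
  "lie_hom K L H =
     {f \<in> module_hom K L H.
        \<forall>x\<in>carrier L. \<forall>y\<in>carrier L. f (bracket L x y) = bracket H (f x) (f y)}"

text \<open>The conjunct \<^term>\<open>vectorspace.fin_dim K V\<close> is needed because \<^const>\<open>vectorspace.dim\<close>
  is not specified for spaces without a finite generating set.\<close>

definition has_dim :: "('k, 'm) ring_scheme \<Rightarrow> ('k, 'v, 'n) module_scheme \<Rightarrow> nat \<Rightarrow> bool" where
  "has_dim K V n \<longleftrightarrow> vectorspace K V \<and> vectorspace.fin_dim K V \<and> vectorspace.dim K V = n"

definition quotient_module ::
  "('k, 'v, 'n) module_scheme \<Rightarrow> 'v set \<Rightarrow> ('k, 'v set) module" where
  "quotient_module V W =
     \<lparr>carrier = a_rcosets\<^bsub>V\<^esub> W,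
      mult = (\<lambda>A B. W),
      one = W,
      zero = W,
      add = (\<lambda>A B. A <+>\<^bsub>V\<^esub> B),
      smult = (\<lambda>a A. \<Union>x\<in>A. W +>\<^bsub>V\<^esub> (a \<odot>\<^bsub>V\<^esub> x))\<rparr>"

definition has_codim ::
  "('k, 'm) ring_scheme \<Rightarrow> ('k, 'v, 'n) module_scheme \<Rightarrow> 'v set \<Rightarrow> nat \<Rightarrow> bool" where
  "has_codim K V W n \<longleftrightarrow> subspace K W V \<and> has_dim K (quotient_module V W) n"

text \<open>
  The tensor product \<open>V \<otimes>\<^sub>K W\<close>: the free \<open>K\<close>-module on \<open>V \<times> W\<close> (functions of finite
  support) modulo the submodule generated by the bilinearity relations.
\<close>

definition free_module :: "('k, 'm) ring_scheme \<Rightarrow> 's set \<Rightarrow> ('k, 's \<Rightarrow> 'k) module" where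
  "free_module K S =
     (ring.func_space K S)
       \<lparr>carrier := {f \<in> carrier (ring.func_space K S). finite {p \<in> S. f p \<noteq> \<zero>\<^bsub>K\<^esub>}}\<rparr>"

definition free_gen :: "('k, 'm) ring_scheme \<Rightarrow> 's set \<Rightarrow> 's \<Rightarrow> 's \<Rightarrow> 'k" where
  "free_gen K S p = (\<lambda>q\<in>S. if q = p then \<one>\<^bsub>K\<^esub> else \<zero>\<^bsub>K\<^esub>)"

definition tensor_relations ::
  "('k, 'm) ring_scheme \<Rightarrow> ('k, 'v, 'n) module_scheme \<Rightarrow> ('k, 'w, 'p) module_scheme
     \<Rightarrow> ('v \<times> 'w \<Rightarrow> 'k) set" where
  "tensor_relations K V W =
     (let S = carrier V \<times> carrier W; F = free_module K S; e = (\<lambda>v w. free_gen K S (v, w)) in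
       {e (v \<oplus>\<^bsub>V\<^esub> v') w \<ominus>\<^bsub>F\<^esub> (e v w \<oplus>\<^bsub>F\<^esub> e v' w) | v v' w.
          v \<in> carrier V \<and> v' \<in> carrier V \<and> w \<in> carrier W} \<union>
       {e v (w \<oplus>\<^bsub>W\<^esub> w') \<ominus>\<^bsub>F\<^esub> (e v w \<oplus>\<^bsub>F\<^esub> e v w') | v w w'.
          v \<in> carrier V \<and> w \<in> carrier W \<and> w' \<in> carrier W} \<union>
       {e (a \<odot>\<^bsub>V\<^esub> v) w \<ominus>\<^bsub>F\<^esub> (a \<odot>\<^bsub>F\<^esub> e v w) | a v w.
          a \<in> carrier K \<and> v \<in> carrier V \<and> w \<in> carrier W} \<union>
       {e v (a \<odot>\<^bsub>W\<^esub> w) \<ominus>\<^bsub>F\<^esub> (a \<odot>\<^bsub>F\<^esub> e v w) | a v w.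
          a \<in> carrier K \<and> v \<in> carrier V \<and> w \<in> carrier W})"

definition tensor_kernel ::
  "('k, 'm) ring_scheme \<Rightarrow> ('k, 'v, 'n) module_scheme \<Rightarrow> ('k, 'w, 'p) module_scheme
     \<Rightarrow> ('v \<times> 'w \<Rightarrow> 'k) set" where
  "tensor_kernel K V W =
     LinearCombinations.module.span K (free_module K (carrier V \<times> carrier W)) (tensor_relations K V W)"

definition tensor_module ::
  "('k, 'm) ring_scheme \<Rightarrow> ('k, 'v, 'n) module_scheme \<Rightarrow> ('k, 'w, 'p) module_scheme
     \<Rightarrow> ('k, ('v \<times> 'w \<Rightarrow> 'k) set) module" where
  "tensor_module K V W =
     quotient_module (free_module K (carrier V \<times> carrier W)) (tensor_kernel K V W)"

definition pure_tensor ::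
  "('k, 'm) ring_scheme \<Rightarrow> ('k, 'v, 'n) module_scheme \<Rightarrow> ('k, 'w, 'p) module_scheme
     \<Rightarrow> 'v \<Rightarrow> 'w \<Rightarrow> ('v \<times> 'w \<Rightarrow> 'k) set" where
  "pure_tensor K V W v w =
     tensor_kernel K V W +>\<^bsub>free_module K (carrier V \<times> carrier W)\<^esub>
       free_gen K (carrier V \<times> carrier W) (v, w)"

text \<open>
  \<open>tensor_lift K V W P h\<close> is the \<open>K\<close>-linear map \<open>V \<otimes>\<^sub>K W \<rightarrow> P\<close> with
  \<open>v \<otimes> w \<mapsto> h v w\<close>, meaningful when \<open>h\<close> is \<open>K\<close>-bilinear: the linear extension of \<open>h\<close> to
  the free module is then constant on each coset \<open>A\<close>, and \<^const>\<open>the_elem\<close> picks its value.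
\<close>

definition tensor_lift ::
  "('k, 'm) ring_scheme \<Rightarrow> ('k, 'v, 'n) module_scheme \<Rightarrow> ('k, 'w, 'p) module_scheme
     \<Rightarrow> ('k, 'x, 'q) module_scheme \<Rightarrow> ('v \<Rightarrow> 'w \<Rightarrow> 'x) \<Rightarrow> ('v \<times> 'w \<Rightarrow> 'k) set \<Rightarrow> 'x" where
  "tensor_lift K V W P h A =
     the_elem ((\<lambda>f. \<Oplus>\<^bsub>P\<^esub> p \<in> {p \<in> carrier V \<times> carrier W. f p \<noteq> \<zero>\<^bsub>K\<^esub>}.
                       f p \<odot>\<^bsub>P\<^esub> h (fst p) (snd p)) ` A)"

text \<open>
  \<open>R \<otimes>\<^sub>K L\<close> as an \<open>R\<close>-Lie algebra: \<open>r (s \<otimes> l) = rs \<otimes> l\<close> and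
  \<open>[r \<otimes> l, s \<otimes> l'] = rs \<otimes> [l, l']\<close>.
\<close>

definition lie_base_change ::
  "('k, 'm) ring_scheme \<Rightarrow> ('k, 'r, 'n) module_scheme \<Rightarrow> ('k, 'l, 'p) module_scheme
     \<Rightarrow> ('r, ('r \<times> 'l \<Rightarrow> 'k) set) module" where
  "lie_base_change K R L =
     (let T = tensor_module K R L in
       \<lparr>carrier = carrier T,
        mult = (\<lambda>A B.
          tensor_lift K R L T
            (\<lambda>r l. tensor_lift K R L T
               (\<lambda>s l'. pure_tensor K R L (r \<otimes>\<^bsub>R\<^esub> s) (bracket L l l')) B) A),
        one = \<zero>\<^bsub>T\<^esub>,
        zero = \<zero>\<^bsub>T\<^esub>,
        add = add T,
        smult = (\<lambda>r. tensor_lift K R L T (\<lambda>s l. pure_tensor K R L (r \<otimes>\<^bsub>R\<^esub> s) l))\<rparr>)"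

text \<open>
  \<open>Der\<^sub>K R\<close> as an \<open>R\<close>-module with the commutator bracket.  Elements are functions that are
  extensional on the carrier of \<open>R\<close>, so that equality of derivations is equality in HOL.
  The bracket is not \<open>R\<close>-bilinear; \<open>Der\<^sub>K R\<close> is a Lie algebra after restriction of scalars
  to \<open>K\<close>.
\<close>

definition derivations ::
  "('k, 'm) ring_scheme \<Rightarrow> ('k, 'r, 'n) module_scheme \<Rightarrow> ('r \<Rightarrow> 'r) set" where
  "derivations K R =
     {D \<in> carrier R \<rightarrow>\<^sub>E carrier R.
        D \<in> module_hom K R R \<and>
        (\<forall>x\<in>carrier R. \<forall>y\<in>carrier R. D (x \<otimes>\<^bsub>R\<^esub> y) = D x \<otimes>\<^bsub>R\<^esub> y \<oplus>\<^bsub>R\<^esub> x \<otimes>\<^bsub>R\<^esub> D y)}"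

definition Der ::
  "('k, 'm) ring_scheme \<Rightarrow> ('k, 'r, 'n) module_scheme \<Rightarrow> ('r, 'r \<Rightarrow> 'r) module" where
  "Der K R =
     \<lparr>carrier = derivations K R,
      mult = (\<lambda>D E. \<lambda>x\<in>carrier R. D (E x) \<ominus>\<^bsub>R\<^esub> E (D x)),
      one = (\<lambda>x\<in>carrier R. \<zero>\<^bsub>R\<^esub>),
      zero = (\<lambda>x\<in>carrier R. \<zero>\<^bsub>R\<^esub>),
      add = (\<lambda>D E. \<lambda>x\<in>carrier R. D x \<oplus>\<^bsub>R\<^esub> E x),
      smult = (\<lambda>r D. \<lambda>x\<in>carrier R. r \<otimes>\<^bsub>R\<^esub> D x)\<rparr>"

definition restrict_scalars ::
  "('k, 'r, 'n) module_scheme \<Rightarrow> ('r, 'v) module \<Rightarrow> ('k, 'v) module" where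
  "restrict_scalars R V =
     \<lparr>carrier = carrier V, mult = mult V, one = one V, zero = zero V, add = add V,
      smult = (\<lambda>a v. (a \<odot>\<^bsub>R\<^esub> \<one>\<^bsub>R\<^esub>) \<odot>\<^bsub>V\<^esub> v)\<rparr>"

text \<open>
  The semidirect product \<open>\<DD>(L, R, M) = M \<oplus> (R \<otimes> L)\<close> for an \<open>R\<close>-submodule \<open>M\<close> of
  \<open>Der\<^sub>K R\<close> closed under the bracket, with \<open>[D, r \<otimes> l] = D(r) \<otimes> l\<close>.
\<close>

definition der_action ::
  "('k, 'm) ring_scheme \<Rightarrow> ('k, 'r, 'n) module_scheme \<Rightarrow> ('k, 'l, 'p) module_scheme
     \<Rightarrow> ('r \<Rightarrow> 'r) \<Rightarrow> ('r \<times> 'l \<Rightarrow> 'k) set \<Rightarrow> ('r \<times> 'l \<Rightarrow> 'k) set" where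
  "der_action K R L D =
     tensor_lift K R L (tensor_module K R L) (\<lambda>r l. pure_tensor K R L (D r) l)"

definition semidirect ::
  "('k, 'm) ring_scheme \<Rightarrow> ('k, 'r, 'n) module_scheme \<Rightarrow> ('k, 'l, 'p) module_scheme
     \<Rightarrow> ('r \<Rightarrow> 'r) set \<Rightarrow> ('r, ('r \<Rightarrow> 'r) \<times> ('r \<times> 'l \<Rightarrow> 'k) set) module" where
  "semidirect K R L M =
     (let T = lie_base_change K R L in
       (direct_sum ((Der K R)\<lparr>carrier := M\<rparr>) T)
         \<lparr>mult := (\<lambda>(D, A) (E, B).
            (bracket (Der K R) D E,
             (der_action K R L D B \<ominus>\<^bsub>T\<^esub> der_action K R L E A) \<oplus>\<^bsub>T\<^esub> bracket T A B))\<rparr>)"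

definition R_span_image ::
  "('k, 'm) ring_scheme \<Rightarrow> ('k, 'r, 'n) module_scheme \<Rightarrow> ('k, 'l, 'p) module_scheme
     \<Rightarrow> ('l \<Rightarrow> 'r \<Rightarrow> 'r) \<Rightarrow> ('r \<Rightarrow> 'r) set" where
  "R_span_image K R L \<phi> = LinearCombinations.module.span R (Der K R) (\<phi> ` carrier L)"

definition phi' ::
  "('k, 'm) ring_scheme \<Rightarrow> ('k, 'r, 'n) module_scheme \<Rightarrow> ('k, 'l, 'p) module_scheme
     \<Rightarrow> ('l \<Rightarrow> 'r \<Rightarrow> 'r) \<Rightarrow> 'l \<Rightarrow> ('r \<Rightarrow> 'r) \<times> ('r \<times> 'l \<Rightarrow> 'k) set" where
  "phi' K R L \<phi> l = (\<phi> l, pure_tensor K R L \<one>\<^bsub>R\<^esub> l)"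

text \<open>\<open>R\<phi>'(L) \<inter> (R \<otimes> L)\<close>, where \<open>R \<otimes> L\<close> sits in the semidirect product as the
  pairs with first component \<open>0\<close>.\<close>

definition L_tilde ::
  "('k, 'm) ring_scheme \<Rightarrow> ('k, 'r, 'n) module_scheme \<Rightarrow> ('k, 'l, 'p) module_scheme
     \<Rightarrow> ('l \<Rightarrow> 'r \<Rightarrow> 'r) \<Rightarrow> ('r \<times> 'l \<Rightarrow> 'k) set set" where
  "L_tilde K R L \<phi> =
     {A \<in> carrier (lie_base_change K R L).
        (\<zero>\<^bsub>Der K R\<^esub>, A) \<in>
          LinearCombinations.module.span R (semidirect K R L (R_span_image K R L \<phi>))
            (phi' K R L \<phi> ` carrier L)}"

end

theory Submission
  imports Defs
begin

text \<open>
  Let \<open>F: R \<otimes> L \<rightarrow> Der R\<close> be the \<open>R\<close>-linear map (the anchor) with \<open>F(r \<otimes> l) = r\<phi>(l)\<close>; its image is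
  \<open>R\<phi>(L)\<close>.  The span of \<open>\<phi>'(L)\<close> is the graph \<open>{(F A, A)}\<close>, so \<open>L_tilde\<close> is the kernel of \<open>F\<close>
  and has codimension \<open>dim R\<phi>(L)\<close>.  \<open>F\<close> is not a Lie homomorphism, but
  \<open>F[A, B] = [F A, F B] - F(F(A).B) + F(F(B).A)\<close>, where \<open>D.(r \<otimes> l) = D(r) \<otimes> l\<close>; hence its kernel is
  closed under the bracket.
\<close>

subsection \<open>Quotient modules\<close>

text \<open>The tensor product is over \<open>K\<close>, while spans and dimensions are over
  \<open>R\<close>. Scaling by \<open>R\<close>, the bracket, the action of a derivation and the
  anchor are all given by \<open>tensor_lift\<close>, which reads a value off a coset and is
  meaningful only once \<open>K\<close>-bilinearity has been checked; what holds over
  \<open>R\<close> is then proved separately on pure tensors. The action A \<mapsto> D.A is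
  \<open>K\<close>-linear but not \<open>R\<close>-linear, so the bracket formula for the anchor
  cannot be extended \<open>R\<close>-linearly from the elements 1 \<otimes> l. Both of its sides
  are merely biadditive, and it has to be checked on all pairs r \<otimes> l, s \<otimes> l', where
  the Leibniz rule produces exactly the two correction terms. These vanish on the kernel because
  each is an action of the derivation F A or F B.\<close>

context LinearCombinations.submodule
begin

text \<open>Working rules that move every operation on cosets to representatives, so that later
  constructions never unfold \<open>quotient_module\<close>. Addition and equality of cosets come
  from the additive group, in which N is a normal subgroup; scaling needs its own argument.\<close>

lemma coset_simps:
  shows a_r_coset_eq_iff: "\<lbrakk>x \<in> carrier M; y \<in> carrier M\<rbrakk> \<Longrightarrow> N +> x = N +> y \<longleftrightarrow> x \<ominus> y \<in> N"
    and mem_a_r_coset: "\<lbrakk>x \<in> carrier M\<rbrakk> \<Longrightarrow> y \<in> N +> x \<longleftrightarrow> y \<in> carrier M \<and> y \<ominus> x \<in> N"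
    and quotient_add: "\<lbrakk>x \<in> carrier M; y \<in> carrier M\<rbrakk> \<Longrightarrow>
      (N +> x) \<oplus>\<^bsub>quotient_module M N\<^esub> (N +> y) = N +> (x \<oplus> y)"
    and quotient_zero: "\<zero>\<^bsub>quotient_module M N\<^esub> = N +> \<zero>"
    and quotient_carrier: "carrier (quotient_module M N) = (\<lambda>x. N +> x) ` carrier M"
    and quotient_smult: "\<lbrakk>a \<in> carrier R; x \<in> carrier M\<rbrakk> \<Longrightarrow>
      a \<odot>\<^bsub>quotient_module M N\<^esub> (N +> x) = N +> (a \<odot> x)"
proof -
  interpret M: module R M by (rule module)
  \<comment> \<open>A submodule is only assumed closed under addition and scaling, so negatives come
    from the scalar -1.\<close>
  have inv: "\<ominus> x \<in> N" if "x \<in> N" for x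
    using that subset M.smult_minus_1[of x] smult_closed[of "\<ominus>\<^bsub>R\<^esub> \<one>\<^bsub>R\<^esub>" x]
    by (metis M.R.add.inv_closed M.R.one_closed subsetD)
  have "N \<noteq> {}" using zero_closed by blast
  then have "subgroup N (add_monoid M)"
    by (intro M.add.subgroupI) (use subset inv in \<open>auto simp: a_inv_def\<close>)
  then interpret abelian_subgroup N M
    by (intro abelian_subgroupI3 additive_subgroupI M.abelian_group_axioms)
  show eq: "N +> x = N +> y \<longleftrightarrow> x \<ominus> y \<in> N" if "x \<in> carrier M" "y \<in> carrier M" for x y
    using that a_rcos_module a_repr_independence' a_repr_independenceD
    by (metis M.minus_eq)
  show mem: "y \<in> N +> x \<longleftrightarrow> y \<in> carrier M \<and> y \<ominus> x \<in> N" if "x \<in> carrier M" for x y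
    using that a_rcos_module M.minus_eq a_elemrcos_carrier by metis
  show "(N +> x) \<oplus>\<^bsub>quotient_module M N\<^esub> (N +> y) = N +> (x \<oplus> y)"
    if "x \<in> carrier M" "y \<in> carrier M" for x y
    using that by (simp add: quotient_module_def a_rcos_sum)
  show "\<zero>\<^bsub>quotient_module M N\<^esub> = N +> \<zero>"
    using subset by (simp add: quotient_module_def)
  show "carrier (quotient_module M N) = (\<lambda>x. N +> x) ` carrier M"
    by (auto simp: quotient_module_def A_RCOSETS_def')
  show "a \<odot>\<^bsub>quotient_module M N\<^esub> (N +> x) = N +> (a \<odot> x)"
    if ax: "a \<in> carrier R" "x \<in> carrier M" for a x
  proof -
    \<comment> \<open>Scaling is a union of cosets over all representatives y of the given coset.
      The union collapses to one coset because a y - a x = a (y - x) lies in N, and because the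
      coset is nonempty.\<close>
    have "N +> (a \<odot> y) = N +> (a \<odot> x)" if "y \<in> N +> x" for y
    proof -
      have y: "y \<in> carrier M" "y \<ominus> x \<in> N" using that mem ax by auto
      then have "a \<odot> y \<ominus> a \<odot> x = a \<odot> (y \<ominus> x)"
        using ax by (simp add: M.minus_eq M.smult_r_distr M.smult_r_minus)
      then show ?thesis using y ax eq by simp
    qed
    moreover have "N +> x \<noteq> {}" using ax mem[of x x] by (auto simp: M.minus_eq M.r_neg)
    ultimately show ?thesis by (simp add: quotient_module_def SUP_eq_const)
  qed
qed

lemma quotient_module_is_module: "module R (quotient_module M N)"
proof -
  interpret M: module R M by (rule module)
  show ?thesis
    by (rule module_criteria)
      (auto simp: quotient_carrier quotient_zero quotient_add quotient_smult M.a_ac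
        M.smult_l_distr M.smult_r_distr M.smult_assoc1 M.R.is_cring M.module_axioms
        intro!: bexI[of _ "\<ominus> _"] M.r_neg arg_cong[of _ _ "\<lambda>x. N +> x"])
qed

end

text \<open>First isomorphism theorem. The isomorphism is taken in the direction from W to V/ker f,
  since the dimension is known on W and is carried forward along a linear bijection.\<close>

lemma has_codim_ker:
  assumes "mod_hom R V W f" and "field R" and surj: "f ` carrier V = carrier W" and "has_dim R W n"
  shows "has_codim R V (mod_hom.ker V W f) n"
proof -
  interpret f: mod_hom R V W f by fact
  interpret fld: field R by fact
  interpret V: vectorspace R V by unfold_locales
  interpret W: vectorspace R W by unfold_locales
  let ?N = "f.ker"
  let ?Q = "quotient_module V ?N"
  interpret N: LinearCombinations.submodule R ?N V by (rule f.ker_is_submodule)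
  interpret Q: module R ?Q by (rule N.quotient_module_is_module)
  interpret Q: vectorspace R ?Q by unfold_locales
  \<comment> \<open>The inverse of the induced map V/ker f \<rightarrow> W, by choosing a preimage;
    two preimages differ by an element of the kernel, so the coset does not depend on the
    choice.\<close>
  define g where "g w = ?N +>\<^bsub>V\<^esub> (SOME v. v \<in> carrier V \<and> f v = w)" for w
  have g_f: "g (f v) = ?N +>\<^bsub>V\<^esub> v" if v: "v \<in> carrier V" for v
  proof -
    define u where "u = (SOME u. u \<in> carrier V \<and> f u = f v)"
    have "u \<in> carrier V" "f u = f v"
      using someI[of "\<lambda>u. u \<in> carrier V \<and> f u = f v" v] v by (auto simp: u_def)
    moreover from this have "u \<ominus>\<^bsub>V\<^esub> v \<in> ?N" using v by (simp add: f.ker_def)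
    ultimately show ?thesis using v N.a_r_coset_eq_iff by (simp add: g_def flip: u_def)
  qed
  have hom: "g \<in> module_hom R W ?Q"
    unfolding module_hom_def
    by (auto simp: surj[symmetric] g_f N.quotient_add N.quotient_smult N.quotient_carrier
        simp flip: f.f_add f.f_smult)
  interpret g: linear_map R W ?Q g
    by unfold_locales (rule hom)
  have g_surj: "g ` carrier W = carrier ?Q"
    by (auto simp: surj[symmetric] g_f N.quotient_carrier image_image)
  have g_inj: "inj_on g (carrier W)"
  proof -
    have "f x = f y" if "x \<in> carrier V" "y \<in> carrier V" "g (f x) = g (f y)" for x y
      using that by (simp add: g_f N.a_r_coset_eq_iff) (simp add: f.ker_def)
    then show ?thesis by (auto simp: surj[symmetric] inj_on_def)
  qed
  have W: "W.fin_dim" "W.dim = n" using \<open>has_dim R W n\<close> by (auto simp: has_dim_def)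
  have "subspace R ?N V" using V.vectorspace_axioms N.submodule_axioms by (simp add: subspace_def)
  then show ?thesis
    using g.surj_fin_dim[OF W(1) g_surj] g.dim_eq[OF W(1) g_inj g_surj] W(2) Q.vectorspace_axioms
    by (simp add: has_codim_def has_dim_def)
qed

subsection \<open>Tensor products\<close>

text \<open>The sum inside \<open>tensor_lift\<close>, isolated so that its linearity on the free
  module can be proved before passing to cosets.\<close>

definition linear_extension ::
  "('k, 'm) ring_scheme \<Rightarrow> ('k, 'x, 'q) module_scheme \<Rightarrow> 's set \<Rightarrow> ('s \<Rightarrow> 'x) \<Rightarrow> ('s \<Rightarrow> 'k) \<Rightarrow> 'x" where
  "linear_extension K P S h f = (\<Oplus>\<^bsub>P\<^esub> p \<in> {p \<in> S. f p \<noteq> \<zero>\<^bsub>K\<^esub>}. f p \<odot>\<^bsub>P\<^esub> h p)"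

section \<open>Free modules and the linear extension of maps on generators\<close>

context cring
begin

lemma free_module_simps:
  shows mem_free_module: "f \<in> carrier (free_module R S) \<longleftrightarrow>
      f \<in> S \<rightarrow>\<^sub>E carrier R \<and> finite {p \<in> S. f p \<noteq> \<zero>}"
    and free_module_zero: "\<zero>\<^bsub>free_module R S\<^esub> = (\<lambda>p\<in>S. \<zero>)"
    and free_module_add: "f \<oplus>\<^bsub>free_module R S\<^esub> g = (\<lambda>p\<in>S. f p \<oplus> g p)"
    and free_module_smult: "c \<odot>\<^bsub>free_module R S\<^esub> f = (\<lambda>p\<in>S. c \<otimes> f p)"
  by (auto simp: free_module_def func_space_def)

lemma free_module_is_module: "module R (free_module R S)"
proof -
  interpret fs: module R "func_space S" by (rule func_space_is_module)
  have "submodule R (carrier (free_module R S)) (func_space S)"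
  proof
    fix v w assume vw: "v \<in> carrier (free_module R S)" "w \<in> carrier (free_module R S)"
    then have "finite ({p \<in> S. v p \<noteq> \<zero>} \<union> {p \<in> S. w p \<noteq> \<zero>})" by (simp add: mem_free_module)
    then have "finite {p \<in> S. v p \<oplus> w p \<noteq> \<zero>}"
      by (rule finite_subset[rotated]) auto
    then show "v \<oplus>\<^bsub>func_space S\<^esub> w \<in> carrier (free_module R S)"
      using vw by (auto simp: mem_free_module func_space_def PiE_iff cong: conj_cong)
  next
    fix c v assume cv: "c \<in> carrier R" "v \<in> carrier (free_module R S)"
    then have "finite {p \<in> S. v p \<noteq> \<zero>}" by (simp add: mem_free_module)
    then have "finite {p \<in> S. c \<otimes> v p \<noteq> \<zero>}"
      by (rule finite_subset[rotated]) (use cv in auto)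
    then show "c \<odot>\<^bsub>func_space S\<^esub> v \<in> carrier (free_module R S)"
      using cv by (auto simp: mem_free_module func_space_def PiE_iff cong: conj_cong)
  qed (auto simp: mem_free_module func_space_def fs.module_axioms)
  from fs.submodule_is_module[OF this] show ?thesis
    by (simp add: free_module_def)
qed

lemma free_gen_closed: "p \<in> S \<Longrightarrow> free_gen R S p \<in> carrier (free_module R S)"
  by (auto simp: free_gen_def mem_free_module cong: conj_cong)

lemma free_module_induct [consumes 1, case_names zero gen add]:
  assumes f: "f \<in> carrier (free_module R S)"
    and zero: "Q (\<zero>\<^bsub>free_module R S\<^esub>)"
    and gen: "\<And>c p. \<lbrakk>c \<in> carrier R; p \<in> S\<rbrakk> \<Longrightarrow> Q (c \<odot>\<^bsub>free_module R S\<^esub> free_gen R S p)"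
    and add: "\<And>f g. \<lbrakk>f \<in> carrier (free_module R S); g \<in> carrier (free_module R S); Q f; Q g\<rbrakk>
      \<Longrightarrow> Q (f \<oplus>\<^bsub>free_module R S\<^esub> g)"
  shows "Q f"
proof -
  interpret F: module R "free_module R S" by (rule free_module_is_module)
  have "finite {p \<in> S. f p \<noteq> \<zero>}" using f by (simp add: mem_free_module)
  moreover have "Q f" if "finite A" "{p \<in> S. f p \<noteq> \<zero>} = A" "f \<in> carrier (free_module R S)" for A f
    using that
  proof (induction A arbitrary: f)
    case empty
    then have "f = \<zero>\<^bsub>free_module R S\<^esub>"
      by (auto simp: mem_free_module free_module_zero PiE_iff extensional_def)
    then show ?case using zero by simp
  next
    case (insert p A)
    have p: "p \<in> S" "f p \<noteq> \<zero>" "f p \<in> carrier R" "f \<in> S \<rightarrow>\<^sub>E carrier R"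
      using insert.prems by (auto simp: mem_free_module)
    \<comment> \<open>Splitting off the coordinate at p leaves the support A, to which the induction
      hypothesis applies; the coefficient \<open>f p\<close> is the scalar c of the generator
      case.\<close>
    let ?g = "f(p := \<zero>)"
    have supp: "{q \<in> S. ?g q \<noteq> \<zero>} = A" using insert.prems insert.hyps by auto
    have g: "?g \<in> carrier (free_module R S)"
      using p supp insert.hyps by (auto simp: mem_free_module PiE_iff extensional_def)
    have eq: "f = f p \<odot>\<^bsub>free_module R S\<^esub> free_gen R S p \<oplus>\<^bsub>free_module R S\<^esub> ?g"
      using p by (auto simp: free_module_add free_module_smult free_gen_def fun_eq_iff PiE_iff
          extensional_def)
    have "f p \<odot>\<^bsub>free_module R S\<^esub> free_gen R S p \<in> carrier (free_module R S)"
      by (rule F.smult_closed[OF p(3) free_gen_closed[OF p(1)]])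
    then show ?case
      by (subst eq) (rule add[OF _ g gen[OF p(3,1)] insert.IH[OF supp g]])
  qed
  ultimately show ?thesis using f by blast
qed

end

context module
begin

text \<open>The sum ranges over the support of f, which changes under addition and scaling.
  Enlarging the range to a common finite set adds only zero terms and allows termwise
  comparison.\<close>

lemma linear_extension_superset:
  assumes "finite A" and "{p \<in> S. f p \<noteq> \<zero>} \<subseteq> A" and "A \<subseteq> S"
    and "f \<in> carrier (free_module R S)" and h: "h \<in> S \<rightarrow> carrier M"
  shows "linear_extension R M S h f = (\<Oplus>\<^bsub>M\<^esub> p \<in> A. f p \<odot>\<^bsub>M\<^esub> h p)"
  unfolding linear_extension_def
  by (rule M.add.finprod_mono_neutral_cong_left)
    (use assms R.mem_free_module[of f S] in \<open>auto simp: PiE_iff Pi_iff subset_iff\<close>)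

lemma linear_extension_hom:
  assumes h: "h \<in> S \<rightarrow> carrier M"
  shows "linear_extension R M S h \<in> module_hom R (free_module R S) M"
proof -
  interpret F: module R "free_module R S" by (rule R.free_module_is_module)
  let ?E = "linear_extension R M S h"
  have hc: "h p \<in> carrier M" if "p \<in> S" for p using h that by auto
  have val: "f p \<in> carrier R" if "f \<in> carrier (free_module R S)" "p \<in> S" for f p
    using that by (auto simp: R.mem_free_module)
  have fin: "finite {p \<in> S. f p \<noteq> \<zero>}" if "f \<in> carrier (free_module R S)" for f
    using that by (simp add: R.mem_free_module)
  have closed: "?E f \<in> carrier M" if "f \<in> carrier (free_module R S)" for f
    unfolding linear_extension_def by (rule M.finsum_closed) (use that val hc in auto)
  moreover have "?E (f \<oplus>\<^bsub>free_module R S\<^esub> g) = ?E f \<oplus>\<^bsub>M\<^esub> ?E g"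
    if fg: "f \<in> carrier (free_module R S)" "g \<in> carrier (free_module R S)" for f g
  proof -
    let ?A = "{p \<in> S. f p \<noteq> \<zero>} \<union> {p \<in> S. g p \<noteq> \<zero>}"
    have A: "finite ?A" "?A \<subseteq> S" using fg fin by auto
    have "?E (f \<oplus>\<^bsub>free_module R S\<^esub> g) =
        (\<Oplus>\<^bsub>M\<^esub> p \<in> ?A. (f \<oplus>\<^bsub>free_module R S\<^esub> g) p \<odot>\<^bsub>M\<^esub> h p)"
      by (rule linear_extension_superset[OF A(1) _ A(2) F.a_closed h])
        (use fg in \<open>auto simp: R.free_module_add\<close>)
    also have "\<dots> = (\<Oplus>\<^bsub>M\<^esub> p \<in> ?A. f p \<odot>\<^bsub>M\<^esub> h p \<oplus>\<^bsub>M\<^esub> g p \<odot>\<^bsub>M\<^esub> h p)"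
      by (rule M.finsum_cong')
        (use fg val hc in \<open>auto simp: R.free_module_add smult_l_distr\<close>)
    also have "\<dots> = (\<Oplus>\<^bsub>M\<^esub> p \<in> ?A. f p \<odot>\<^bsub>M\<^esub> h p) \<oplus>\<^bsub>M\<^esub> (\<Oplus>\<^bsub>M\<^esub> p \<in> ?A. g p \<odot>\<^bsub>M\<^esub> h p)"
      by (rule M.finsum_addf) (use fg val hc in auto)
    also have "\<dots> = ?E f \<oplus>\<^bsub>M\<^esub> ?E g"
      using linear_extension_superset[OF A(1) _ A(2) _ h] fg by auto
    finally show ?thesis .
  qed
  moreover have "?E (c \<odot>\<^bsub>free_module R S\<^esub> f) = c \<odot>\<^bsub>M\<^esub> ?E f"
    if cf: "c \<in> carrier R" "f \<in> carrier (free_module R S)" for c f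
  proof -
    let ?A = "{p \<in> S. f p \<noteq> \<zero>}"
    have A: "finite ?A" "?A \<subseteq> S" using cf fin by auto
    have "?E (c \<odot>\<^bsub>free_module R S\<^esub> f) = (\<Oplus>\<^bsub>M\<^esub> p \<in> ?A. (c \<odot>\<^bsub>free_module R S\<^esub> f) p \<odot>\<^bsub>M\<^esub> h p)"
      by (rule linear_extension_superset[OF A(1) _ A(2) F.smult_closed h])
        (use cf in \<open>auto simp: R.free_module_smult\<close>)
    also have "\<dots> = (\<Oplus>\<^bsub>M\<^esub> p \<in> ?A. c \<odot>\<^bsub>M\<^esub> (f p \<odot>\<^bsub>M\<^esub> h p))"
      by (rule M.finsum_cong')
        (use cf val hc in \<open>auto simp: R.free_module_smult smult_assoc1\<close>)
    also have "\<dots> = c \<odot>\<^bsub>M\<^esub> ?E f"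
      unfolding linear_extension_def
      by (rule finsum_smult_ldistr[symmetric]) (use A cf val hc in auto)
    finally show ?thesis .
  qed
  ultimately show ?thesis by (auto simp: module_hom_def)
qed

lemma linear_extension_gen:
  assumes h: "h \<in> S \<rightarrow> carrier M" and p: "p \<in> S"
  shows "linear_extension R M S h (free_gen R S p) = h p"
proof -
  have hp: "h p \<in> carrier M" using assms by auto
  \<comment> \<open>Enlarging to {p} also covers the trivial ring, where 1 = 0 and the support of
    the generator is empty.\<close>
  have "linear_extension R M S h (free_gen R S p) = (\<Oplus>\<^bsub>M\<^esub> q \<in> {p}. free_gen R S p q \<odot>\<^bsub>M\<^esub> h q)"
    by (rule linear_extension_superset) (use assms R.free_gen_closed in \<open>auto simp: free_gen_def\<close>)
  also have "\<dots> = h p"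
    using hp p by (simp add: free_gen_def)
  finally show ?thesis .
qed

end

text \<open>Phrased by partial maps in \<open>module_hom\<close>, so that facts on homomorphisms
  such as preservation of zero apply in each argument; \<open>bilinear_iff\<close> is the equational
  form.\<close>

definition bilinear ::
  "('k, 'm) ring_scheme \<Rightarrow> ('k, 'v, 'n) module_scheme \<Rightarrow> ('k, 'w, 'p) module_scheme
     \<Rightarrow> ('k, 'x, 'q) module_scheme \<Rightarrow> ('v \<Rightarrow> 'w \<Rightarrow> 'x) \<Rightarrow> bool" where
  "bilinear K V W P h \<longleftrightarrow>
     (\<forall>v\<in>carrier V. h v \<in> module_hom K W P) \<and>
     (\<forall>w\<in>carrier W. (\<lambda>v. h v w) \<in> module_hom K V P)"

lemma bilinear_iff:
  "bilinear K V W P h \<longleftrightarrow>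
    (\<forall>v\<in>carrier V. \<forall>w\<in>carrier W. h v w \<in> carrier P) \<and>
    (\<forall>v\<in>carrier V. \<forall>v'\<in>carrier V. \<forall>w\<in>carrier W. h (v \<oplus>\<^bsub>V\<^esub> v') w = h v w \<oplus>\<^bsub>P\<^esub> h v' w) \<and>
    (\<forall>v\<in>carrier V. \<forall>w\<in>carrier W. \<forall>w'\<in>carrier W. h v (w \<oplus>\<^bsub>W\<^esub> w') = h v w \<oplus>\<^bsub>P\<^esub> h v w') \<and>
    (\<forall>a\<in>carrier K. \<forall>v\<in>carrier V. \<forall>w\<in>carrier W. h (a \<odot>\<^bsub>V\<^esub> v) w = a \<odot>\<^bsub>P\<^esub> h v w) \<and>
    (\<forall>a\<in>carrier K. \<forall>v\<in>carrier V. \<forall>w\<in>carrier W. h v (a \<odot>\<^bsub>W\<^esub> w) = a \<odot>\<^bsub>P\<^esub> h v w)"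
  unfolding bilinear_def module_hom_def by (simp add: Pi_iff) blast

lemma bilinearD:
  assumes "bilinear K V W P h"
  shows "(\<lambda>p. h (fst p) (snd p)) \<in> carrier V \<times> carrier W \<rightarrow> carrier P"
    and "\<lbrakk>v \<in> carrier V; w \<in> carrier W\<rbrakk> \<Longrightarrow> h v w \<in> carrier P"
    and "\<lbrakk>v \<in> carrier V; v' \<in> carrier V; w \<in> carrier W\<rbrakk>
      \<Longrightarrow> h (v \<oplus>\<^bsub>V\<^esub> v') w = h v w \<oplus>\<^bsub>P\<^esub> h v' w"
    and "\<lbrakk>v \<in> carrier V; w \<in> carrier W; w' \<in> carrier W\<rbrakk>
      \<Longrightarrow> h v (w \<oplus>\<^bsub>W\<^esub> w') = h v w \<oplus>\<^bsub>P\<^esub> h v w'"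
    and "\<lbrakk>a \<in> carrier K; v \<in> carrier V; w \<in> carrier W\<rbrakk> \<Longrightarrow> h (a \<odot>\<^bsub>V\<^esub> v) w = a \<odot>\<^bsub>P\<^esub> h v w"
    and "\<lbrakk>a \<in> carrier K; v \<in> carrier V; w \<in> carrier W\<rbrakk> \<Longrightarrow> h v (a \<odot>\<^bsub>W\<^esub> w) = a \<odot>\<^bsub>P\<^esub> h v w"
  using assms by (auto simp: bilinear_iff)

locale tensor_product = V: module K V + W: module K W for K and V and W
begin

abbreviation "S \<equiv> carrier V \<times> carrier W"
abbreviation "F \<equiv> free_module K S"
abbreviation "T \<equiv> tensor_module K V W"
abbreviation "N \<equiv> tensor_kernel K V W"
abbreviation gen where "gen v w \<equiv> free_gen K S (v, w)"
abbreviation pure (infixl "\<otimes>\<^sub>T" 75) where "v \<otimes>\<^sub>T w \<equiv> pure_tensor K V W v w"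

sublocale F: module K F
  by (rule V.R.free_module_is_module)

lemma gen_closed: "\<lbrakk>v \<in> carrier V; w \<in> carrier W\<rbrakk> \<Longrightarrow> gen v w \<in> carrier F"
  by (rule V.R.free_gen_closed) simp

lemma relations_closed: "tensor_relations K V W \<subseteq> carrier F"
  by (auto simp: tensor_relations_def Let_def gen_closed)

lemma kernel_submodule: "LinearCombinations.submodule K N F"
  unfolding tensor_kernel_def by (rule F.span_is_submodule[OF relations_closed])

sublocale N: LinearCombinations.submodule K N F
  by (rule kernel_submodule)

sublocale T: module K T
  unfolding tensor_module_def by (rule N.quotient_module_is_module)

lemma relation_mem_kernel: "x \<in> tensor_relations K V W \<Longrightarrow> x \<in> N"
  using F.in_own_span[OF relations_closed] by (auto simp: tensor_kernel_def)

lemma bilinearity_mem_kernel: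
  "\<lbrakk>v \<in> carrier V; v' \<in> carrier V; w \<in> carrier W\<rbrakk>
    \<Longrightarrow> gen (v \<oplus>\<^bsub>V\<^esub> v') w \<ominus>\<^bsub>F\<^esub> (gen v w \<oplus>\<^bsub>F\<^esub> gen v' w) \<in> N"
  "\<lbrakk>v \<in> carrier V; w \<in> carrier W; w' \<in> carrier W\<rbrakk>
    \<Longrightarrow> gen v (w \<oplus>\<^bsub>W\<^esub> w') \<ominus>\<^bsub>F\<^esub> (gen v w \<oplus>\<^bsub>F\<^esub> gen v w') \<in> N"
  "\<lbrakk>a \<in> carrier K; v \<in> carrier V; w \<in> carrier W\<rbrakk>
    \<Longrightarrow> gen (a \<odot>\<^bsub>V\<^esub> v) w \<ominus>\<^bsub>F\<^esub> (a \<odot>\<^bsub>F\<^esub> gen v w) \<in> N"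
  "\<lbrakk>a \<in> carrier K; v \<in> carrier V; w \<in> carrier W\<rbrakk>
    \<Longrightarrow> gen v (a \<odot>\<^bsub>W\<^esub> w) \<ominus>\<^bsub>F\<^esub> (a \<odot>\<^bsub>F\<^esub> gen v w) \<in> N"
  by (rule relation_mem_kernel, unfold tensor_relations_def Let_def, blast)+

lemma pure_closed: "\<lbrakk>v \<in> carrier V; w \<in> carrier W\<rbrakk> \<Longrightarrow> v \<otimes>\<^sub>T w \<in> carrier T"
  by (simp add: pure_tensor_def tensor_module_def N.quotient_carrier gen_closed)

lemma bilinear_pure: "bilinear K V W T (pure_tensor K V W)"
  unfolding bilinear_iff pure_tensor_def tensor_module_def
  by (simp add: N.quotient_add N.quotient_smult N.quotient_carrier N.a_r_coset_eq_iff gen_closed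
      bilinearity_mem_kernel)

text \<open>No case for scalars is needed: c (v \<otimes> w) = (c v) \<otimes> w is again a pure
  tensor. Any identity additive in one tensor argument thus reduces to pure tensors in that
  argument.\<close>

lemma tensor_induct [consumes 1, case_names zero pure add]:
  assumes A: "A \<in> carrier T"
    and zero_T: "Q (\<zero>\<^bsub>T\<^esub>)"
    and pure: "\<And>v w. \<lbrakk>v \<in> carrier V; w \<in> carrier W\<rbrakk> \<Longrightarrow> Q (v \<otimes>\<^sub>T w)"
    and add_T: "\<And>A B. \<lbrakk>A \<in> carrier T; B \<in> carrier T; Q A; Q B\<rbrakk> \<Longrightarrow> Q (A \<oplus>\<^bsub>T\<^esub> B)"
  shows "Q A"
proof -
  obtain f where f: "f \<in> carrier F" "A = N +>\<^bsub>F\<^esub> f"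
    using A by (auto simp: tensor_module_def N.quotient_carrier)
  from f(1) have "Q (N +>\<^bsub>F\<^esub> f)"
  proof (induction f rule: V.R.free_module_induct)
    case zero
    then show ?case using zero_T by (simp add: tensor_module_def N.quotient_zero)
  next
    case (gen c p)
    then obtain v w where p: "p = (v, w)" "v \<in> carrier V" "w \<in> carrier W" by auto
    have "N +>\<^bsub>F\<^esub> (c \<odot>\<^bsub>F\<^esub> gen v w) = c \<odot>\<^bsub>T\<^esub> (v \<otimes>\<^sub>T w)"
      using gen p by (simp add: tensor_module_def pure_tensor_def N.quotient_smult gen_closed)
    also have "\<dots> = (c \<odot>\<^bsub>V\<^esub> v) \<otimes>\<^sub>T w"
      using gen p by (simp add: bilinearD[OF bilinear_pure])
    finally show ?case using pure gen p by simp
  next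
    case (add f g)
    then have "Q ((N +>\<^bsub>F\<^esub> f) \<oplus>\<^bsub>T\<^esub> (N +>\<^bsub>F\<^esub> g))"
      by (intro add_T) (simp_all add: tensor_module_def N.quotient_carrier)
    then show ?case using add by (simp add: tensor_module_def N.quotient_add)
  qed
  then show ?thesis using f by simp
qed

section \<open>Universal property: linear maps induced by bilinear maps\<close>

context
  fixes P :: "('a, 'x, 'q) module_scheme" and h
  assumes P: "module K P" and h: "bilinear K V W P h"
begin

interpretation P: module K P by (rule P)

text \<open>Bilinearity of h says that the defining relations are sent to zero; the kernel of the
  extension is a submodule, so it contains their span.\<close>

lemma linear_extension_eq_0_on_kernel:
  assumes "x \<in> N"
  shows "linear_extension K P S (\<lambda>p. h (fst p) (snd p)) x = \<zero>\<^bsub>P\<^esub>"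
proof -
  let ?h = "\<lambda>p. h (fst p) (snd p)"
  note hS = bilinearD(1)[OF h]
  interpret E: mod_hom K F P "linear_extension K P S ?h"
    by unfold_locales (rule P.linear_extension_hom[OF hS])
  have "tensor_relations K V W \<subseteq> E.ker"
    using relations_closed
    by (auto simp: E.ker_def tensor_relations_def Let_def gen_closed P.linear_extension_gen[OF hS]
        bilinearD[OF h])
  then have "N \<subseteq> E.ker"
    unfolding tensor_kernel_def by (rule F.span_is_subset[OF _ E.ker_is_submodule])
  then show ?thesis using assms by (auto simp: E.ker_def)
qed

text \<open>This makes \<open>the_elem\<close> legitimate: two members of a coset differ by an
  element of the tensor kernel, so the image of the coset is a singleton.\<close>

lemma tensor_lift_coset:
  assumes f: "f \<in> carrier F"
  shows "tensor_lift K V W P h (N +>\<^bsub>F\<^esub> f) = linear_extension K P S (\<lambda>p. h (fst p) (snd p)) f"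
proof -
  let ?h = "\<lambda>p. h (fst p) (snd p)"
  note hS = bilinearD(1)[OF h]
  interpret E: mod_hom K F P "linear_extension K P S ?h"
    by unfold_locales (rule P.linear_extension_hom[OF hS])
  have "tensor_lift K V W P h (N +>\<^bsub>F\<^esub> f) = the_elem (linear_extension K P S ?h ` (N +>\<^bsub>F\<^esub> f))"
    by (simp add: tensor_lift_def linear_extension_def)
  also have "\<dots> = linear_extension K P S ?h f"
  proof (rule the_elem_image_unique)
    show "N +>\<^bsub>F\<^esub> f \<noteq> {}"
      using f N.mem_a_r_coset[OF f, of f] by (auto simp: F.minus_eq F.r_neg)
    show "linear_extension K P S ?h g = linear_extension K P S ?h f" if "g \<in> N +>\<^bsub>F\<^esub> f" for g
      using that f linear_extension_eq_0_on_kernel[of "g \<ominus>\<^bsub>F\<^esub> f"] by (simp add: N.mem_a_r_coset)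
  qed
  finally show ?thesis .
qed

lemma tensor_lift_hom: "tensor_lift K V W P h \<in> module_hom K T P"
proof -
  note hS = bilinearD(1)[OF h]
  note E = P.linear_extension_hom[OF hS]
  show ?thesis
    unfolding module_hom_def tensor_module_def
    using E by (auto simp: N.quotient_carrier N.quotient_add N.quotient_smult tensor_lift_coset
        module_hom_def)
qed

lemma tensor_lift_pure:
  assumes "v \<in> carrier V" "w \<in> carrier W"
  shows "tensor_lift K V W P h (v \<otimes>\<^sub>T w) = h v w"
proof -
  note hS = bilinearD(1)[OF h]
  show ?thesis
    using assms P.linear_extension_gen[OF hS, of "(v, w)"]
    by (simp add: pure_tensor_def tensor_lift_coset gen_closed)
qed

end

end

lemma (in algebra) smult_mult_commute:
  "\<lbrakk>a \<in> carrier R; x \<in> carrier M; y \<in> carrier M\<rbrakk> \<Longrightarrow> x \<otimes>\<^bsub>M\<^esub> (a \<odot>\<^bsub>M\<^esub> y) = a \<odot>\<^bsub>M\<^esub> (x \<otimes>\<^bsub>M\<^esub> y)"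
  using smult_assoc2 m_comm smult_closed by metis

subsection \<open>Extension of scalars of a Lie algebra\<close>

lemma module_hom_zero:
  assumes "module K V" "module K W" "f \<in> module_hom K V W"
  shows "f \<zero>\<^bsub>V\<^esub> = \<zero>\<^bsub>W\<^esub>"
proof -
  interpret mod_hom K V W f using assms by (simp add: mod_hom_def mod_hom_axioms_def)
  show ?thesis by simp
qed

locale scalar_extension = tensor_product K R L + R: field R + alg: algebra K R + lie: lie_algebra K L
  for K :: "('k, 'm) ring_scheme" and R :: "('k, 'r, 'n) module_scheme" (structure)
    and L :: "('k, 'l, 'p) module_scheme"
begin

notation pure (infixl "\<otimes>\<^sub>T" 75)

abbreviation "RL \<equiv> lie_base_change K R L"

lemmas pure_bilinear = bilinearD(2-)[OF bilinear_pure]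

lemma base_change_simps:
  "carrier RL = carrier T" "\<zero>\<^bsub>RL\<^esub> = \<zero>\<^bsub>T\<^esub>" "x \<oplus>\<^bsub>RL\<^esub> y = x \<oplus>\<^bsub>T\<^esub> y"
  by (simp_all add: lie_base_change_def Let_def)

lemma pure_zero_left: "l \<in> carrier L \<Longrightarrow> \<zero> \<otimes>\<^sub>T l = \<zero>\<^bsub>T\<^esub>"
  using bilinear_pure module_hom_zero[OF V.module_axioms T.module_axioms] by (auto simp: bilinear_def)

lemma pure_zero_right: "r \<in> carrier R \<Longrightarrow> r \<otimes>\<^sub>T \<zero>\<^bsub>L\<^esub> = \<zero>\<^bsub>T\<^esub>"
  using bilinear_pure module_hom_zero[OF W.module_axioms T.module_axioms] by (auto simp: bilinear_def)

lemma
  assumes r: "r \<in> carrier R"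
  shows base_change_smult_hom: "(\<odot>\<^bsub>RL\<^esub>) r \<in> module_hom K T T"
    and base_change_smult_pure: "\<lbrakk>s \<in> carrier R; l \<in> carrier L\<rbrakk> \<Longrightarrow> r \<odot>\<^bsub>RL\<^esub> (s \<otimes>\<^sub>T l) = (r \<otimes> s) \<otimes>\<^sub>T l"
proof -
  have eq: "(\<odot>\<^bsub>RL\<^esub>) r = tensor_lift K R L T (\<lambda>s l. (r \<otimes> s) \<otimes>\<^sub>T l)"
    by (simp add: lie_base_change_def Let_def)
  have "bilinear K R L T (\<lambda>s l. (r \<otimes> s) \<otimes>\<^sub>T l)"
    using r by (simp add: bilinear_iff pure_bilinear R.r_distr alg.smult_mult_commute)
  from tensor_lift_hom[OF T.module_axioms this] tensor_lift_pure[OF T.module_axioms this]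
  show "(\<odot>\<^bsub>RL\<^esub>) r \<in> module_hom K T T"
    and "\<lbrakk>s \<in> carrier R; l \<in> carrier L\<rbrakk> \<Longrightarrow> r \<odot>\<^bsub>RL\<^esub> (s \<otimes>\<^sub>T l) = (r \<otimes> s) \<otimes>\<^sub>T l"
    by (simp_all add: eq)
qed

lemma base_change_smult_closed [simp]:
  "\<lbrakk>r \<in> carrier R; A \<in> carrier T\<rbrakk> \<Longrightarrow> r \<odot>\<^bsub>RL\<^esub> A \<in> carrier T"
  using module_hom_closed[OF base_change_smult_hom] by blast

lemma base_change_smult_add:
  "\<lbrakk>r \<in> carrier R; A \<in> carrier T; B \<in> carrier T\<rbrakk> \<Longrightarrow> r \<odot>\<^bsub>RL\<^esub> (A \<oplus>\<^bsub>T\<^esub> B) = r \<odot>\<^bsub>RL\<^esub> A \<oplus>\<^bsub>T\<^esub> r \<odot>\<^bsub>RL\<^esub> B"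
  using module_hom_add[OF base_change_smult_hom] by blast

lemma base_change_smult_zero: "r \<in> carrier R \<Longrightarrow> r \<odot>\<^bsub>RL\<^esub> \<zero>\<^bsub>T\<^esub> = \<zero>\<^bsub>T\<^esub>"
  using module_hom_zero[OF T.module_axioms T.module_axioms base_change_smult_hom] by blast

text \<open>Additivity in the tensor is part of scaling being a lift. The laws in the scalar compare
  additive functions of A, so they reduce to the laws of \<open>R\<close> in the first factor of a
  pure tensor.\<close>

lemma base_change_module: "module R RL"
proof (rule module_criteria)
  show "\<forall>v\<in>carrier RL. \<exists>w\<in>carrier RL. v \<oplus>\<^bsub>RL\<^esub> w = \<zero>\<^bsub>RL\<^esub>"
    by (auto simp: base_change_simps intro!: bexI[of _ "\<ominus>\<^bsub>T\<^esub> _"] T.r_neg)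
  have "(r \<otimes> s) \<odot>\<^bsub>RL\<^esub> A = r \<odot>\<^bsub>RL\<^esub> (s \<odot>\<^bsub>RL\<^esub> A)"
    if "A \<in> carrier T" "r \<in> carrier R" "s \<in> carrier R" for r s A
    using that by (induction rule: tensor_induct)
      (simp_all add: base_change_smult_pure base_change_smult_add base_change_smult_zero R.m_assoc)
  then show "\<forall>r s A. r \<in> carrier R \<and> s \<in> carrier R \<and> A \<in> carrier RL
      \<longrightarrow> (r \<otimes> s) \<odot>\<^bsub>RL\<^esub> A = r \<odot>\<^bsub>RL\<^esub> (s \<odot>\<^bsub>RL\<^esub> A)"
    by (simp add: base_change_simps)
  have "\<one> \<odot>\<^bsub>RL\<^esub> A = A" if "A \<in> carrier T" for A
    using that by (induction rule: tensor_induct)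
      (simp_all add: base_change_smult_pure base_change_smult_add base_change_smult_zero)
  then show "\<forall>A\<in>carrier RL. \<one> \<odot>\<^bsub>RL\<^esub> A = A"
    by (simp add: base_change_simps)
  have "(r \<oplus> s) \<odot>\<^bsub>RL\<^esub> A = r \<odot>\<^bsub>RL\<^esub> A \<oplus>\<^bsub>T\<^esub> s \<odot>\<^bsub>RL\<^esub> A"
    if "A \<in> carrier T" "r \<in> carrier R" "s \<in> carrier R" for r s A
    using that by (induction rule: tensor_induct)
      (simp_all add: base_change_smult_pure base_change_smult_add base_change_smult_zero
        R.l_distr pure_bilinear T.a_ac)
  then show "\<forall>r s A. r \<in> carrier R \<and> s \<in> carrier R \<and> A \<in> carrier RL
      \<longrightarrow> (r \<oplus> s) \<odot>\<^bsub>RL\<^esub> A = r \<odot>\<^bsub>RL\<^esub> A \<oplus>\<^bsub>RL\<^esub> s \<odot>\<^bsub>RL\<^esub> A"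
    by (simp add: base_change_simps)
qed (auto simp: base_change_simps base_change_smult_add R.is_cring T.a_ac)

text \<open>The bracket is a lift nested in a lift. The inner one gives linearity in B for a fixed
  pure left argument; the outer one is meaningful only after the inner one is shown bilinear in (r,
  l) for each fixed B.\<close>

lemma
  shows base_change_bracket_hom: "B \<in> carrier T \<Longrightarrow> (\<lambda>A. bracket RL A B) \<in> module_hom K T T"
    and base_change_bracket_pure_hom: "\<lbrakk>r \<in> carrier R; l \<in> carrier L\<rbrakk>
      \<Longrightarrow> bracket RL (r \<otimes>\<^sub>T l) \<in> module_hom K T T"
    and base_change_bracket_pure:
      "\<lbrakk>r \<in> carrier R; l \<in> carrier L; s \<in> carrier R; l' \<in> carrier L\<rbrakk>
      \<Longrightarrow> bracket RL (r \<otimes>\<^sub>T l) (s \<otimes>\<^sub>T l') = (r \<otimes> s) \<otimes>\<^sub>T bracket L l l'"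
proof -
  define ad where "ad r l = tensor_lift K R L T (\<lambda>s l'. (r \<otimes> s) \<otimes>\<^sub>T bracket L l l')" for r l
  have eq: "bracket RL A B = tensor_lift K R L T (\<lambda>r l. ad r l B) A" for A B
    by (simp add: lie_base_change_def Let_def ad_def)
  have bil: "bilinear K R L T (\<lambda>s l'. (r \<otimes> s) \<otimes>\<^sub>T bracket L l l')"
    if "r \<in> carrier R" "l \<in> carrier L" for r l
    using that by (simp add: bilinear_iff pure_bilinear R.r_distr alg.smult_mult_commute
        lie.bracket_closed lie.bracket_add_right lie.bracket_smult_right)
  note ad_hom = tensor_lift_hom[OF T.module_axioms bil, folded ad_def]
  note ad_pure = tensor_lift_pure[OF T.module_axioms bil, folded ad_def]
  have ad_closed: "ad r l B \<in> carrier T"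
    if "r \<in> carrier R" "l \<in> carrier L" "B \<in> carrier T" for r l B
    using module_hom_closed[OF ad_hom] that by blast
  note ad_simps = ad_pure ad_closed module_hom_zero[OF T.module_axioms T.module_axioms ad_hom]
    module_hom_add[OF ad_hom] pure_bilinear R.l_distr alg.smult_assoc2 lie.bracket_closed
    lie.bracket_add_left lie.bracket_smult_left T.a_ac T.smult_r_distr
  \<comment> \<open>These four identities are additive in B by \<open>ad_hom\<close>, so bilinearity
    in (r, l) can be tested on pure B.\<close>
  have "ad (r \<oplus> r') l B = ad r l B \<oplus>\<^bsub>T\<^esub> ad r' l B"
    if "B \<in> carrier T" "r \<in> carrier R" "r' \<in> carrier R" "l \<in> carrier L" for r r' l B
    using that by (induction rule: tensor_induct) (simp_all add: ad_simps)
  moreover have "ad r (l \<oplus>\<^bsub>L\<^esub> l') B = ad r l B \<oplus>\<^bsub>T\<^esub> ad r l' B"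
    if "B \<in> carrier T" "r \<in> carrier R" "l \<in> carrier L" "l' \<in> carrier L" for r l l' B
    using that by (induction rule: tensor_induct) (simp_all add: ad_simps)
  moreover have "ad (a \<odot> r) l B = a \<odot>\<^bsub>T\<^esub> ad r l B"
    if "B \<in> carrier T" "a \<in> carrier K" "r \<in> carrier R" "l \<in> carrier L" for a r l B
    using that by (induction rule: tensor_induct) (simp_all add: ad_simps)
  moreover have "ad r (a \<odot>\<^bsub>L\<^esub> l) B = a \<odot>\<^bsub>T\<^esub> ad r l B"
    if "B \<in> carrier T" "a \<in> carrier K" "r \<in> carrier R" "l \<in> carrier L" for a r l B
    using that by (induction rule: tensor_induct) (simp_all add: ad_simps)
  ultimately have ad_bil: "bilinear K R L T (\<lambda>r l. ad r l B)" if "B \<in> carrier T" for B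
    using that by (simp add: bilinear_iff ad_closed)
  show "(\<lambda>A. bracket RL A B) \<in> module_hom K T T" if "B \<in> carrier T"
    using tensor_lift_hom[OF T.module_axioms ad_bil[OF that]] by (simp add: eq)
  have pure: "bracket RL (r \<otimes>\<^sub>T l) B = ad r l B"
    if "B \<in> carrier T" "r \<in> carrier R" "l \<in> carrier L" for r l B
    using tensor_lift_pure[OF T.module_axioms ad_bil] that by (simp add: eq)
  show "bracket RL (r \<otimes>\<^sub>T l) \<in> module_hom K T T" if "r \<in> carrier R" "l \<in> carrier L"
    using ad_hom[OF that] pure that by (simp add: module_hom_def Pi_iff)
  show "bracket RL (r \<otimes>\<^sub>T l) (s \<otimes>\<^sub>T l') = (r \<otimes> s) \<otimes>\<^sub>T bracket L l l'"
    if "r \<in> carrier R" "l \<in> carrier L" "s \<in> carrier R" "l' \<in> carrier L"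
    using that by (simp add: pure ad_pure pure_closed)
qed

lemma base_change_bracket_closed [simp]:
  "\<lbrakk>A \<in> carrier T; B \<in> carrier T\<rbrakk> \<Longrightarrow> bracket RL A B \<in> carrier T"
  using module_hom_closed[OF base_change_bracket_hom] by blast

lemma base_change_bracket_add_left:
  "\<lbrakk>A \<in> carrier T; A' \<in> carrier T; B \<in> carrier T\<rbrakk>
    \<Longrightarrow> bracket RL (A \<oplus>\<^bsub>T\<^esub> A') B = bracket RL A B \<oplus>\<^bsub>T\<^esub> bracket RL A' B"
  using module_hom_add[OF base_change_bracket_hom] by blast

lemma base_change_bracket_zero_left: "B \<in> carrier T \<Longrightarrow> bracket RL \<zero>\<^bsub>T\<^esub> B = \<zero>\<^bsub>T\<^esub>"
  using module_hom_zero[OF T.module_axioms T.module_axioms base_change_bracket_hom] by blast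

text \<open>The outer lift gives linearity on the left only. Additivity on the right is known for
  pure A and spreads to all A because both sides are additive in A.\<close>

lemma base_change_bracket_add_right:
  assumes "A \<in> carrier T" "B \<in> carrier T" "B' \<in> carrier T"
  shows "bracket RL A (B \<oplus>\<^bsub>T\<^esub> B') = bracket RL A B \<oplus>\<^bsub>T\<^esub> bracket RL A B'"
  using assms by (induction rule: tensor_induct)
    (simp_all add: base_change_bracket_zero_left base_change_bracket_add_left
      module_hom_add[OF base_change_bracket_pure_hom] T.a_ac)

lemma base_change_bracket_zero_right:
  assumes "A \<in> carrier T"
  shows "bracket RL A \<zero>\<^bsub>T\<^esub> = \<zero>\<^bsub>T\<^esub>"
  using assms by (induction rule: tensor_induct)
    (simp_all add: base_change_bracket_zero_left base_change_bracket_add_left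
      module_hom_zero[OF T.module_axioms T.module_axioms base_change_bracket_pure_hom])

lemmas base_change_bracket_simps = base_change_bracket_add_left base_change_bracket_add_right
  base_change_bracket_zero_left base_change_bracket_zero_right base_change_bracket_pure

lemma base_change_bracket_smult_left:
  assumes "A \<in> carrier T" "B \<in> carrier T" "c \<in> carrier R"
  shows "bracket RL (c \<odot>\<^bsub>RL\<^esub> A) B = c \<odot>\<^bsub>RL\<^esub> bracket RL A B"
  using assms(1)
proof (induction rule: tensor_induct)
  case (pure r l)
  show ?case
    using \<open>B \<in> carrier T\<close> by (induction rule: tensor_induct)
      (use pure \<open>c \<in> carrier R\<close> in \<open>simp_all add: base_change_bracket_simps base_change_smult_pure
        base_change_smult_add base_change_smult_zero pure_closed lie.bracket_closed R.m_assoc\<close>)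
qed (use assms in \<open>simp_all add: base_change_bracket_simps base_change_smult_add
      base_change_smult_zero\<close>)

lemma base_change_bracket_smult_right:
  assumes "A \<in> carrier T" "B \<in> carrier T" "c \<in> carrier R"
  shows "bracket RL A (c \<odot>\<^bsub>RL\<^esub> B) = c \<odot>\<^bsub>RL\<^esub> bracket RL A B"
  using assms(1)
proof (induction rule: tensor_induct)
  case (pure r l)
  show ?case
    using \<open>B \<in> carrier T\<close> by (induction rule: tensor_induct)
      (use pure \<open>c \<in> carrier R\<close> in \<open>simp_all add: base_change_bracket_simps base_change_smult_pure
        base_change_smult_add base_change_smult_zero pure_closed lie.bracket_closed R.m_lcomm\<close>)
qed (use assms in \<open>simp_all add: base_change_bracket_simps base_change_smult_add
      base_change_smult_zero\<close>)

section \<open>Alternation and the Jacobi identity after extension of scalars\<close>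

lemma bracket_anticommute:
  assumes "l \<in> carrier L" "l' \<in> carrier L"
  shows "bracket L l l' \<oplus>\<^bsub>L\<^esub> bracket L l' l = \<zero>\<^bsub>L\<^esub>"
proof -
  have "bracket L l l' \<oplus>\<^bsub>L\<^esub> bracket L l' l = bracket L (l \<oplus>\<^bsub>L\<^esub> l') (l \<oplus>\<^bsub>L\<^esub> l')"
    using assms by (simp add: lie.bracket_add_left lie.bracket_add_right lie.bracket_closed
        lie.bracket_self[OF assms(1)] lie.bracket_self[OF assms(2)] W.a_comm)
  then show ?thesis using assms by (simp add: lie.bracket_self)
qed

lemma base_change_bracket_anticommute:
  assumes "A \<in> carrier T" "B \<in> carrier T"
  shows "bracket RL A B \<oplus>\<^bsub>T\<^esub> bracket RL B A = \<zero>\<^bsub>T\<^esub>"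
  using assms(1)
proof (induction rule: tensor_induct)
  case zero
  then show ?case using assms by (simp add: base_change_bracket_simps)
next
  case (pure r l)
  show ?case
    using \<open>B \<in> carrier T\<close>
  proof (induction rule: tensor_induct)
    case zero
    then show ?case using pure by (simp add: base_change_bracket_simps pure_closed)
  next
    case (pure s l')
    then show ?case
      using \<open>r \<in> carrier R\<close> \<open>l \<in> carrier L\<close>
      by (simp add: base_change_bracket_simps pure_closed lie.bracket_closed R.m_comm[of s r]
          bracket_anticommute pure_zero_right flip: pure_bilinear(3))
  next
    \<comment> \<open>The four brackets regroup into one antisymmetric pair for B and one for
      B'.\<close>
    case (add B B')
    then have "bracket RL (r \<otimes>\<^sub>T l) (B \<oplus>\<^bsub>T\<^esub> B') \<oplus>\<^bsub>T\<^esub> bracket RL (B \<oplus>\<^bsub>T\<^esub> B') (r \<otimes>\<^sub>T l)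
       = (bracket RL (r \<otimes>\<^sub>T l) B \<oplus>\<^bsub>T\<^esub> bracket RL B (r \<otimes>\<^sub>T l)) \<oplus>\<^bsub>T\<^esub>
         (bracket RL (r \<otimes>\<^sub>T l) B' \<oplus>\<^bsub>T\<^esub> bracket RL B' (r \<otimes>\<^sub>T l))"
      using pure by (simp add: base_change_bracket_simps pure_closed T.a_ac)
    then show ?case using add by simp
  qed
next
  case (add A A')
  then have "bracket RL (A \<oplus>\<^bsub>T\<^esub> A') B \<oplus>\<^bsub>T\<^esub> bracket RL B (A \<oplus>\<^bsub>T\<^esub> A')
     = (bracket RL A B \<oplus>\<^bsub>T\<^esub> bracket RL B A) \<oplus>\<^bsub>T\<^esub> (bracket RL A' B \<oplus>\<^bsub>T\<^esub> bracket RL B A')"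
    using assms by (simp add: base_change_bracket_simps T.a_ac)
  then show ?case using add by simp
qed

text \<open>[A, A] is quadratic in A, not additive, so induction leaves the cross terms [A, B] +
  [B, A]; this is why anticommutativity comes beforehand.\<close>

lemma base_change_bracket_self:
  assumes "A \<in> carrier T"
  shows "bracket RL A A = \<zero>\<^bsub>T\<^esub>"
  using assms
proof (induction rule: tensor_induct)
  case (pure r l)
  then show ?case by (simp add: base_change_bracket_simps lie.bracket_self pure_zero_right)
next
  case (add A B)
  then have "bracket RL (A \<oplus>\<^bsub>T\<^esub> B) (A \<oplus>\<^bsub>T\<^esub> B) = bracket RL A B \<oplus>\<^bsub>T\<^esub> bracket RL B A"
    by (simp add: base_change_bracket_simps T.a_comm)
  then show ?case using add by (simp add: base_change_bracket_anticommute)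
qed (simp add: base_change_bracket_simps)

text \<open>The Jacobi sum is additive in its first argument and invariant under cyclic rotation,
  hence additive in each. The arguments are made pure one at a time, each being rotated to the front
  for its induction.\<close>

lemma base_change_jacobi:
  assumes "A \<in> carrier T" "B \<in> carrier T" "C \<in> carrier T"
  shows "bracket RL A (bracket RL B C) \<oplus>\<^bsub>T\<^esub> bracket RL B (bracket RL C A)
    \<oplus>\<^bsub>T\<^esub> bracket RL C (bracket RL A B) = \<zero>\<^bsub>T\<^esub>" (is "?J A B C = _")
proof -
  have add1: "?J (A \<oplus>\<^bsub>T\<^esub> A') B C = ?J A B C \<oplus>\<^bsub>T\<^esub> ?J A' B C"
    if "A \<in> carrier T" "A' \<in> carrier T" "B \<in> carrier T" "C \<in> carrier T" for A A' B C
    using that by (simp add: base_change_bracket_simps T.a_ac)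
  have cyc: "?J A B C = ?J B C A"
    if "A \<in> carrier T" "B \<in> carrier T" "C \<in> carrier T" for A B C
    using that by (simp add: T.a_ac)
  have pure3: "?J (r \<otimes>\<^sub>T l) (s \<otimes>\<^sub>T m) (t \<otimes>\<^sub>T n) = \<zero>\<^bsub>T\<^esub>"
    if "r \<in> carrier R" "l \<in> carrier L" "s \<in> carrier R" "m \<in> carrier L" "t \<in> carrier R"
      "n \<in> carrier L" for r s t l m n
  proof -
    \<comment> \<open>The three scalar factors are brought to one common form, so that the sum
      collects in the second tensor slot, where it is the Jacobi sum of \<open>L\<close>.\<close>
    have "s \<otimes> (t \<otimes> r) = r \<otimes> (s \<otimes> t)" "t \<otimes> (r \<otimes> s) = r \<otimes> (s \<otimes> t)"
      using that by (simp_all add: R.m_ac)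
    then show ?thesis
      using that by (simp add: base_change_bracket_simps lie.bracket_closed lie.jacobi
          pure_zero_right flip: pure_bilinear(3))
  qed
  have pure2: "?J (r \<otimes>\<^sub>T l) (s \<otimes>\<^sub>T m) C = \<zero>\<^bsub>T\<^esub>"
    if C: "C \<in> carrier T" and "r \<in> carrier R" "l \<in> carrier L" "s \<in> carrier R" "m \<in> carrier L"
    for r s l m C
    using C
  proof (induction rule: tensor_induct)
    case (add C C')
    then show ?case
      using that cyc[of "r \<otimes>\<^sub>T l" "s \<otimes>\<^sub>T m"] cyc[of _ "r \<otimes>\<^sub>T l" "s \<otimes>\<^sub>T m"] add1[of C C' "r \<otimes>\<^sub>T l" "s \<otimes>\<^sub>T m"]
      by (simp add: pure_closed)
  next
    case (pure t n)
    then show ?case using that by (simp only: pure3)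
  qed (use that in \<open>simp add: base_change_bracket_simps pure_closed lie.bracket_closed\<close>)
  have pure1: "?J (r \<otimes>\<^sub>T l) B C = \<zero>\<^bsub>T\<^esub>"
    if B: "B \<in> carrier T" and "C \<in> carrier T" "r \<in> carrier R" "l \<in> carrier L" for r l B C
    using B
  proof (induction rule: tensor_induct)
    case (add B B')
    then show ?case
      using that cyc[of "r \<otimes>\<^sub>T l" _ C] add1[of B B' C "r \<otimes>\<^sub>T l"] by (simp add: pure_closed)
  next
    case (pure t n)
    then show ?case using that by (simp only: pure2)
  qed (use that in \<open>simp_all add: base_change_bracket_simps pure_closed\<close>)
  show ?thesis
    using assms(1)
  proof (induction rule: tensor_induct)
    case (add A A')
    then show ?case using assms add1 by simp
  next
    case (pure t n)
    then show ?case using assms by (simp only: pure1)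
  qed (use assms in \<open>simp_all add: base_change_bracket_simps\<close>)
qed

lemma base_change_lie_algebra: "lie_algebra R RL"
  using base_change_module R.field_axioms
  by (intro lie_algebra.intro lie_algebra_axioms.intro vectorspace.intro)
    (simp_all add: base_change_simps base_change_bracket_simps base_change_bracket_smult_left
      base_change_bracket_smult_right base_change_bracket_self base_change_jacobi)

end

subsection \<open>Derivations\<close>

lemma module_restrict_scalars:
  assumes "algebra K R" and "module R V"
  shows "module K (restrict_scalars R V)"
proof -
  interpret alg: algebra K R by fact
  interpret V: module R V by fact
  show ?thesis
  proof (rule module_criteria)
    show "\<forall>v\<in>carrier (restrict_scalars R V). \<exists>w\<in>carrier (restrict_scalars R V).
        v \<oplus>\<^bsub>restrict_scalars R V\<^esub> w = \<zero>\<^bsub>restrict_scalars R V\<^esub>"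
      by (auto simp: restrict_scalars_def intro!: bexI[of _ "\<ominus>\<^bsub>V\<^esub> _"] V.M.r_neg)
    \<comment> \<open>Associativity of the restricted action amounts to a \<mapsto> a 1 being
      multiplicative.\<close>
    have "((a \<otimes>\<^bsub>K\<^esub> b) \<odot>\<^bsub>R\<^esub> \<one>\<^bsub>R\<^esub>) = (a \<odot>\<^bsub>R\<^esub> \<one>\<^bsub>R\<^esub>) \<otimes>\<^bsub>R\<^esub> (b \<odot>\<^bsub>R\<^esub> \<one>\<^bsub>R\<^esub>)"
      if "a \<in> carrier K" "b \<in> carrier K" for a b
      using that by (simp add: alg.smult_assoc1 alg.smult_assoc2)
    then show "\<forall>a b v. a \<in> carrier K \<and> b \<in> carrier K \<and> v \<in> carrier (restrict_scalars R V) \<longrightarrow>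
      (a \<otimes>\<^bsub>K\<^esub> b) \<odot>\<^bsub>restrict_scalars R V\<^esub> v =
       a \<odot>\<^bsub>restrict_scalars R V\<^esub> (b \<odot>\<^bsub>restrict_scalars R V\<^esub> v)"
      by (simp add: restrict_scalars_def V.smult_assoc1)
  qed (auto simp: restrict_scalars_def alg.R_cring V.M.a_ac alg.smult_l_distr V.smult_l_distr
      V.smult_r_distr)
qed

context algebra
begin

lemma Der_simps:
  "carrier (Der R M) = derivations R M"
  "bracket (Der R M) D E = (\<lambda>x\<in>carrier M. D (E x) \<ominus>\<^bsub>M\<^esub> E (D x))"
  "\<zero>\<^bsub>Der R M\<^esub> = (\<lambda>x\<in>carrier M. \<zero>\<^bsub>M\<^esub>)"
  "D \<oplus>\<^bsub>Der R M\<^esub> E = (\<lambda>x\<in>carrier M. D x \<oplus>\<^bsub>M\<^esub> E x)"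
  "r \<odot>\<^bsub>Der R M\<^esub> D = (\<lambda>x\<in>carrier M. r \<otimes>\<^bsub>M\<^esub> D x)"
  by (simp_all add: Der_def)

lemma derivation_iff:
  "D \<in> derivations R M \<longleftrightarrow> D \<in> extensional (carrier M) \<and>
    (\<forall>x\<in>carrier M. D x \<in> carrier M) \<and>
    (\<forall>x\<in>carrier M. \<forall>y\<in>carrier M. D (x \<oplus>\<^bsub>M\<^esub> y) = D x \<oplus>\<^bsub>M\<^esub> D y) \<and>
    (\<forall>a\<in>carrier R. \<forall>x\<in>carrier M. D (a \<odot>\<^bsub>M\<^esub> x) = a \<odot>\<^bsub>M\<^esub> D x) \<and>
    (\<forall>x\<in>carrier M. \<forall>y\<in>carrier M. D (x \<otimes>\<^bsub>M\<^esub> y) = D x \<otimes>\<^bsub>M\<^esub> y \<oplus>\<^bsub>M\<^esub> x \<otimes>\<^bsub>M\<^esub> D y)"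
  unfolding derivations_def module_hom_def by (auto simp: PiE_iff Pi_iff)

lemma derivationD:
  assumes "D \<in> derivations R M"
  shows "D \<in> extensional (carrier M)"
    and "x \<in> carrier M \<Longrightarrow> D x \<in> carrier M"
    and "\<lbrakk>x \<in> carrier M; y \<in> carrier M\<rbrakk> \<Longrightarrow> D (x \<oplus>\<^bsub>M\<^esub> y) = D x \<oplus>\<^bsub>M\<^esub> D y"
    and "\<lbrakk>a \<in> carrier R; x \<in> carrier M\<rbrakk> \<Longrightarrow> D (a \<odot>\<^bsub>M\<^esub> x) = a \<odot>\<^bsub>M\<^esub> D x"
    and "\<lbrakk>x \<in> carrier M; y \<in> carrier M\<rbrakk> \<Longrightarrow> D (x \<otimes>\<^bsub>M\<^esub> y) = D x \<otimes>\<^bsub>M\<^esub> y \<oplus>\<^bsub>M\<^esub> x \<otimes>\<^bsub>M\<^esub> D y"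
  using assms by (auto simp: derivation_iff)

lemma derivation_zero:
  assumes "D \<in> derivations R M"
  shows "D \<zero>\<^bsub>M\<^esub> = \<zero>\<^bsub>M\<^esub>"
  using derivationD(3)[OF assms, of "\<zero>\<^bsub>M\<^esub>" "\<zero>\<^bsub>M\<^esub>"] derivationD(2)[OF assms, of "\<zero>\<^bsub>M\<^esub>"] by simp

text \<open>Commutativity of the algebra is what keeps a multiple r D a derivation: r has to pass x
  in the Leibniz rule. Closure under scaling comes first because (-1) D then serves as the additive
  inverse.\<close>

lemma Der_module: "module M (Der R M)"
proof (rule module_criteria)
  let ?D = "Der R M"
  have ext: "D = E" if "D \<in> extensional (carrier M)" "E \<in> extensional (carrier M)"
      "\<And>x. x \<in> carrier M \<Longrightarrow> D x = E x" for D E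
    using that by (rule extensionalityI)
  note closed = derivationD(2)
  show smult: "\<forall>c v. c \<in> carrier M \<and> v \<in> carrier ?D \<longrightarrow> c \<odot>\<^bsub>?D\<^esub> v \<in> carrier ?D"
  proof (intro allI impI, elim conjE)
    fix c v assume "c \<in> carrier M" "v \<in> carrier ?D"
    then show "c \<odot>\<^bsub>?D\<^esub> v \<in> carrier ?D"
      by (simp add: Der_simps derivation_iff r_distr smult_mult_commute m_ac)
  qed
  show "\<forall>v\<in>carrier ?D. \<exists>w\<in>carrier ?D. v \<oplus>\<^bsub>?D\<^esub> w = \<zero>\<^bsub>?D\<^esub>"
  proof
    fix D assume D: "D \<in> carrier ?D"
    show "\<exists>w\<in>carrier ?D. D \<oplus>\<^bsub>?D\<^esub> w = \<zero>\<^bsub>?D\<^esub>"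
    proof
      show "(\<ominus>\<^bsub>M\<^esub> \<one>\<^bsub>M\<^esub>) \<odot>\<^bsub>?D\<^esub> D \<in> carrier ?D" using smult D by simp
      show "D \<oplus>\<^bsub>?D\<^esub> (\<ominus>\<^bsub>M\<^esub> \<one>\<^bsub>M\<^esub>) \<odot>\<^bsub>?D\<^esub> D = \<zero>\<^bsub>?D\<^esub>"
        using D by (auto simp: Der_simps derivation_iff l_minus M.r_neg intro!: restrict_ext)
    qed
  qed
  show "\<forall>v w. v \<in> carrier ?D \<and> w \<in> carrier ?D \<longrightarrow> v \<oplus>\<^bsub>?D\<^esub> w \<in> carrier ?D"
    by (auto simp: Der_simps derivation_iff smult_r_distr r_distr l_distr M.a_ac)
qed (auto simp: Der_simps derivation_iff M.a_ac m_assoc r_distr l_distr M_cring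
    intro!: extensionalityI[of _ "carrier M"])

end

subsection \<open>The anchor map\<close>

text \<open>The semidirect product is a direct sum of modules with its bracket field overwritten;
  this carries the module axioms over to it.\<close>

lemma module_mult_update:
  assumes "module R V"
  shows "module R (V\<lparr>mult := f\<rparr>)"
proof -
  interpret V: module R V by fact
  show ?thesis
    by (rule module_criteria)
      (auto simp: V.R.is_cring V.M.a_ac V.smult_l_distr V.smult_r_distr V.smult_assoc1
        intro!: bexI[of _ "\<ominus>\<^bsub>V\<^esub> _"] V.M.r_neg)
qed

locale lie_extension = scalar_extension K R L
  for K :: "('k, 'm) ring_scheme" and R :: "('k, 'r, 'n) module_scheme" (structure)
    and L :: "('k, 'l, 'p) module_scheme" +
  fixes \<phi> :: "'l \<Rightarrow> 'r \<Rightarrow> 'r"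
  assumes phi: "\<phi> \<in> lie_hom K L (restrict_scalars R (Der K R))"
begin

notation pure (infixl "\<otimes>\<^sub>T" 75)

abbreviation "DR \<equiv> Der K R"

sublocale DR: module R DR
  by (rule alg.Der_module)

lemmas Der_simps = alg.Der_simps
lemmas derivationD = alg.derivationD

lemma phi_derivation: "l \<in> carrier L \<Longrightarrow> \<phi> l \<in> derivations K R"
  and phi_add: "\<lbrakk>l \<in> carrier L; l' \<in> carrier L\<rbrakk> \<Longrightarrow> \<phi> (l \<oplus>\<^bsub>L\<^esub> l') = \<phi> l \<oplus>\<^bsub>DR\<^esub> \<phi> l'"
  and phi_smult: "\<lbrakk>a \<in> carrier K; l \<in> carrier L\<rbrakk> \<Longrightarrow> \<phi> (a \<odot>\<^bsub>L\<^esub> l) = (a \<odot> \<one>) \<odot>\<^bsub>DR\<^esub> \<phi> l"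
  and phi_bracket: "\<lbrakk>l \<in> carrier L; l' \<in> carrier L\<rbrakk> \<Longrightarrow> \<phi> (bracket L l l') = bracket DR (\<phi> l) (\<phi> l')"
  using phi by (auto simp: lie_hom_def module_hom_def restrict_scalars_def Der_simps)

lemma phi_closed: "l \<in> carrier L \<Longrightarrow> \<phi> l \<in> carrier DR"
  by (simp add: Der_simps phi_derivation)

text \<open>A lift over \<open>K\<close> needs a \<open>K\<close>-module as its target, hence the
  restricted scalars; \<open>R\<close>-linearity is recovered in
  \<open>anchor_smult\<close>.\<close>

definition anchor :: "('r \<times> 'l \<Rightarrow> 'k) set \<Rightarrow> 'r \<Rightarrow> 'r" where
  "anchor = tensor_lift K R L (restrict_scalars R DR) (\<lambda>r l. r \<odot>\<^bsub>DR\<^esub> \<phi> l)"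

lemma
  shows anchor_hom_K: "anchor \<in> module_hom K T (restrict_scalars R DR)"
    and anchor_pure: "\<lbrakk>r \<in> carrier R; l \<in> carrier L\<rbrakk> \<Longrightarrow> anchor (r \<otimes>\<^sub>T l) = r \<odot>\<^bsub>DR\<^esub> \<phi> l"
proof -
  have mod: "module K (restrict_scalars R DR)"
    by (rule module_restrict_scalars[OF alg.algebra_axioms DR.module_axioms])
  \<comment> \<open>A scalar a of \<open>K\<close> in either slot comes out as a 1 acting on r
    \<phi>(l).\<close>
  have "bilinear K R L (restrict_scalars R DR) (\<lambda>r l. r \<odot>\<^bsub>DR\<^esub> \<phi> l)"
    unfolding bilinear_iff
    by (simp add: restrict_scalars_def phi_closed phi_add phi_smult DR.smult_l_distr
        DR.smult_r_distr alg.smult_mult_commute alg.smult_assoc2 flip: DR.smult_assoc1)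
  from tensor_lift_hom[OF mod this] tensor_lift_pure[OF mod this]
  show "anchor \<in> module_hom K T (restrict_scalars R DR)"
    and "\<lbrakk>r \<in> carrier R; l \<in> carrier L\<rbrakk> \<Longrightarrow> anchor (r \<otimes>\<^sub>T l) = r \<odot>\<^bsub>DR\<^esub> \<phi> l"
    by (simp_all add: anchor_def)
qed

lemma anchor_closed: "A \<in> carrier T \<Longrightarrow> anchor A \<in> carrier DR"
  using module_hom_closed[OF anchor_hom_K] by (auto simp: restrict_scalars_def)

lemma anchor_derivation: "A \<in> carrier T \<Longrightarrow> anchor A \<in> derivations K R"
  using anchor_closed by (simp add: Der_simps)

lemma anchor_add: "\<lbrakk>A \<in> carrier T; B \<in> carrier T\<rbrakk> \<Longrightarrow> anchor (A \<oplus>\<^bsub>T\<^esub> B) = anchor A \<oplus>\<^bsub>DR\<^esub> anchor B"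
  using module_hom_add[OF anchor_hom_K] by (simp add: restrict_scalars_def)

lemma anchor_zero: "anchor \<zero>\<^bsub>T\<^esub> = \<zero>\<^bsub>DR\<^esub>"
  using module_hom_zero[OF T.module_axioms _ anchor_hom_K]
    module_restrict_scalars[OF alg.algebra_axioms DR.module_axioms]
  by (simp add: restrict_scalars_def)

lemma anchor_smult:
  assumes "A \<in> carrier T" "r \<in> carrier R"
  shows "anchor (r \<odot>\<^bsub>RL\<^esub> A) = r \<odot>\<^bsub>DR\<^esub> anchor A"
  using assms by (induction rule: tensor_induct)
    (simp_all add: anchor_pure anchor_add anchor_zero anchor_closed base_change_smult_pure
      base_change_smult_add base_change_smult_zero DR.smult_r_distr DR.smult_assoc1 phi_closed)

lemma
  assumes D: "D \<in> derivations K R"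
  shows der_action_hom: "der_action K R L D \<in> module_hom K T T"
    and der_action_pure: "\<lbrakk>r \<in> carrier R; l \<in> carrier L\<rbrakk> \<Longrightarrow> der_action K R L D (r \<otimes>\<^sub>T l) = D r \<otimes>\<^sub>T l"
proof -
  have "bilinear K R L T (\<lambda>r l. D r \<otimes>\<^sub>T l)"
    by (simp add: bilinear_iff pure_bilinear derivationD[OF D])
  from tensor_lift_hom[OF T.module_axioms this] tensor_lift_pure[OF T.module_axioms this]
  show "der_action K R L D \<in> module_hom K T T"
    and "\<lbrakk>r \<in> carrier R; l \<in> carrier L\<rbrakk> \<Longrightarrow> der_action K R L D (r \<otimes>\<^sub>T l) = D r \<otimes>\<^sub>T l"
    by (simp_all add: der_action_def)
qed

lemma der_action_closed:
  "\<lbrakk>D \<in> derivations K R; A \<in> carrier T\<rbrakk> \<Longrightarrow> der_action K R L D A \<in> carrier T"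
  using module_hom_closed[OF der_action_hom] by blast

lemmas der_action_right = module_hom_add[OF der_action_hom]
  module_hom_zero[OF T.module_axioms T.module_axioms der_action_hom]

text \<open>Makes F(F(A).B) additive in A as well as in B, as needed to reduce the bracket formula
  to pure tensors.\<close>

lemma der_action_add_left:
  assumes "A \<in> carrier T" "D \<in> derivations K R" "E \<in> derivations K R"
  shows "der_action K R L (D \<oplus>\<^bsub>DR\<^esub> E) A = der_action K R L D A \<oplus>\<^bsub>T\<^esub> der_action K R L E A"
proof -
  have DE: "D \<oplus>\<^bsub>DR\<^esub> E \<in> derivations K R"
    using assms DR.M.a_closed by (simp add: Der_simps(1))
  show ?thesis
    using assms(1) by (induction rule: tensor_induct)
      (use assms(2,3) DE in \<open>simp_all add: der_action_right der_action_pure der_action_closed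
        T.a_ac, simp_all add: Der_simps pure_bilinear derivationD\<close>)
qed

lemma der_action_zero_left:
  assumes "A \<in> carrier T"
  shows "der_action K R L \<zero>\<^bsub>DR\<^esub> A = \<zero>\<^bsub>T\<^esub>"
proof -
  have 0: "\<zero>\<^bsub>DR\<^esub> \<in> derivations K R"
    using DR.M.zero_closed by (simp add: Der_simps(1))
  show ?thesis
    using assms by (induction rule: tensor_induct)
      (use 0 in \<open>simp_all add: der_action_right der_action_pure,
        simp add: Der_simps pure_zero_left\<close>)
qed

text \<open>\<open>[r\<phi>(l), s\<phi>(l')] = rs[\<phi>(l), \<phi>(l')] + r\<phi>(l)(s)\<phi>(l') - s\<phi>(l')(r)\<phi>(l)\<close>, rearranged so that no
  subtraction occurs.\<close>

lemma anchor_bracket: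
  assumes "A \<in> carrier T" "B \<in> carrier T" and x: "x \<in> carrier R"
  shows "anchor (bracket RL A B) x \<oplus> anchor (der_action K R L (anchor A) B) x \<oplus> anchor B (anchor A x)
    = anchor A (anchor B x) \<oplus> anchor (der_action K R L (anchor B) A) x" (is "?l A B = ?r A B")
proof -
  have fn_add: "(D \<oplus>\<^bsub>DR\<^esub> E) y = D y \<oplus> E y" if "y \<in> carrier R" for D E y
    using that by (simp add: Der_simps)
  have fn_zero: "\<zero>\<^bsub>DR\<^esub> y = \<zero>" if "y \<in> carrier R" for y
    using that by (simp add: Der_simps)
  note [simp] = base_change_bracket_simps anchor_add anchor_derivation der_action_right
    der_action_closed der_action_add_left anchor_zero der_action_zero_left
    derivationD(2,3) alg.derivation_zero fn_add fn_zero
  note [simp del] = base_change_bracket_pure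
  \<comment> \<open>Evaluated at x, both sides are additive in A and in B; for the composites this
    uses additivity of derivations on \<open>R\<close>.\<close>
  have l_add1: "?l (A \<oplus>\<^bsub>T\<^esub> A') B = ?l A B \<oplus> ?l A' B" and r_add1: "?r (A \<oplus>\<^bsub>T\<^esub> A') B = ?r A B \<oplus> ?r A' B"
    and l_add2: "?l B (A \<oplus>\<^bsub>T\<^esub> A') = ?l B A \<oplus> ?l B A'" and r_add2: "?r B (A \<oplus>\<^bsub>T\<^esub> A') = ?r B A \<oplus> ?r B A'"
    if "A \<in> carrier T" "A' \<in> carrier T" "B \<in> carrier T" for A A' B
    using that x by (simp_all add: V.M.a_ac)
  have pure2: "?l (r \<otimes>\<^sub>T l) (s \<otimes>\<^sub>T m) = ?r (r \<otimes>\<^sub>T l) (s \<otimes>\<^sub>T m)"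
    if "r \<in> carrier R" "l \<in> carrier L" "s \<in> carrier R" "m \<in> carrier L" for r l s m
  proof -
    note D = phi_derivation[OF that(2)] phi_derivation[OF that(4)]
    note cl = D[THEN derivationD(2)] that x
    \<comment> \<open>The commutator, with its negative term moved to the other side.\<close>
    have "\<phi> (bracket L l m) x \<oplus> \<phi> m (\<phi> l x) = \<phi> l (\<phi> m x)"
      using cl by (simp add: phi_bracket Der_simps V.M.minus_eq V.M.a_assoc V.M.l_neg)
    then have *: "(r \<otimes> s) \<otimes> \<phi> l (\<phi> m x)
        = (r \<otimes> s) \<otimes> \<phi> (bracket L l m) x \<oplus> (r \<otimes> s) \<otimes> \<phi> m (\<phi> l x)"
      using cl phi_derivation[OF lie.bracket_closed, THEN derivationD(2)]
      by (simp flip: R.r_distr)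
    have val: "anchor (t \<otimes>\<^sub>T n) y = t \<otimes> \<phi> n y"
      if "t \<in> carrier R" "n \<in> carrier L" "y \<in> carrier R" for t n y
      using that by (simp add: anchor_pure Der_simps)
    have "?l (r \<otimes>\<^sub>T l) (s \<otimes>\<^sub>T m) = (r \<otimes> s) \<otimes> \<phi> (bracket L l m) x \<oplus> (r \<otimes> \<phi> l s) \<otimes> \<phi> m x
        \<oplus> s \<otimes> \<phi> m (r \<otimes> \<phi> l x)"
      using cl by (simp add: base_change_bracket_pure val der_action_pure pure_closed
          lie.bracket_closed)
    \<comment> \<open>The Leibniz rule splits s \<phi>(m)(r \<phi>(l) x) into a second-order part
      and the part containing \<phi>(m)(r).\<close>
    also have "\<dots> = ((r \<otimes> s) \<otimes> \<phi> (bracket L l m) x \<oplus> (r \<otimes> s) \<otimes> \<phi> m (\<phi> l x))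
        \<oplus> (r \<otimes> \<phi> l s) \<otimes> \<phi> m x \<oplus> (s \<otimes> \<phi> m r) \<otimes> \<phi> l x"
      using cl D phi_derivation[OF lie.bracket_closed, THEN derivationD(2)]
      by (simp add: derivationD(5) R.r_distr V.M.a_ac R.m_ac)
    \<comment> \<open>The second-order terms combine to r s \<phi>(l)(\<phi>(m) x); with r
      \<phi>(l)(s) \<phi>(m) x this is the Leibniz rule read backwards.\<close>
    also have "\<dots> = r \<otimes> \<phi> l (s \<otimes> \<phi> m x) \<oplus> (s \<otimes> \<phi> m r) \<otimes> \<phi> l x"
      unfolding *[symmetric]
      using cl D by (simp add: derivationD(5) R.r_distr V.M.a_ac R.m_ac)
    also have "\<dots> = ?r (r \<otimes>\<^sub>T l) (s \<otimes>\<^sub>T m)"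
      using cl by (simp add: val der_action_pure pure_closed)
    finally show ?thesis .
  qed
  have pure1: "?l (r \<otimes>\<^sub>T l) B = ?r (r \<otimes>\<^sub>T l) B"
    if B: "B \<in> carrier T" and rl: "r \<in> carrier R" "l \<in> carrier L" for r l B
    using B
  proof (induction rule: tensor_induct)
    case zero
    then show ?case using rl x by (simp add: pure_closed)
  next
    case (pure s m)
    then show ?case using rl by (intro pure2)
  next
    case (add B B')
    then show ?case using rl by (simp only: l_add2 r_add2 pure_closed)
  qed
  show ?thesis
    using assms(1)
  proof (induction rule: tensor_induct)
    case zero
    then show ?case using assms by simp
  next
    case (pure s m)
    then show ?case using assms by (intro pure1)
  next
    case (add A A')
    then show ?case using assms by (simp only: l_add1 r_add1)
  qed
qed

section \<open>The image of the anchor, its graph and its kernel\<close>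

abbreviation "MR \<equiv> R_span_image K R L \<phi>"

lemma image_closed: "\<phi> ` carrier L \<subseteq> carrier DR"
  using phi_closed by auto

lemma MR_submodule: "LinearCombinations.submodule R MR DR"
  unfolding R_span_image_def by (rule DR.span_is_submodule[OF image_closed])

sublocale MR: LinearCombinations.submodule R MR DR
  by (rule MR_submodule)

text \<open>Values on pure tensors are multiples of elements \<phi>(l), hence in the span.
  Conversely the image is an \<open>R\<close>-submodule containing every \<phi>(l) = F(1 \<otimes>
  l).\<close>

lemma anchor_image: "anchor ` carrier T = MR"
proof
  have "anchor A \<in> MR" if "A \<in> carrier T" for A
    using that
  proof (induction rule: tensor_induct)
    case (pure r l)
    then have "\<phi> l \<in> MR"
      using DR.in_own_span[OF image_closed] by (auto simp: R_span_image_def)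
    then show ?case using pure by (simp add: anchor_pure)
  qed (simp_all add: anchor_zero anchor_add)
  then show "anchor ` carrier T \<subseteq> MR" by blast
next
  interpret RL: module R RL by (rule base_change_module)
  interpret anchor: mod_hom R RL DR anchor
    by unfold_locales
      (auto simp: module_hom_def base_change_simps anchor_add anchor_smult anchor_closed)
  have "\<phi> l \<in> anchor.im" if "l \<in> carrier L" for l
    using anchor_pure[OF R.one_closed that] that phi_closed[OF that]
    by (auto simp: anchor.im_def base_change_simps pure_closed intro!: image_eqI[of _ _ "\<one> \<otimes>\<^sub>T l"])
  then have "MR \<subseteq> anchor.im"
    unfolding R_span_image_def
    by (intro DR.span_is_subset[OF _ anchor.im_is_submodule]) auto
  then show "MR \<subseteq> anchor ` carrier T"
    by (simp add: anchor.im_def base_change_simps)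
qed

text \<open>The target is cut down to the span so that the anchor becomes surjective, as
  \<open>has_codim_ker\<close> requires; the zero element, and with it the kernel, stays the
  same.\<close>

sublocale anchor: mod_hom R RL "DR\<lparr>carrier := MR\<rparr>" anchor
proof -
  interpret RL: module R RL by (rule base_change_module)
  interpret M: module R "DR\<lparr>carrier := MR\<rparr>" by (rule DR.submodule_is_module[OF MR_submodule])
  show "mod_hom R RL (DR\<lparr>carrier := MR\<rparr>) anchor"
    by unfold_locales
      (auto simp: module_hom_def base_change_simps anchor_add anchor_smult simp flip: anchor_image)
qed

text \<open>\<phi>'(l) is the graph point over 1 \<otimes> l, and the graph of an
  \<open>R\<close>-linear map is a submodule, so it contains the span. Conversely r \<phi>'(l) is
  the graph point over r \<otimes> l, and sums of such points exhaust the graph.\<close>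

lemma span_phi'_eq_graph:
  "LinearCombinations.module.span R (semidirect K R L MR) (phi' K R L \<phi> ` carrier L)
    = (\<lambda>A. (anchor A, A)) ` carrier T" (is "?span = ?graph")
proof -
  let ?SD = "semidirect K R L MR"
  interpret SD: module R ?SD
    unfolding semidirect_def Let_def
    by (intro module_mult_update direct_sum_is_module anchor.M.module_axioms anchor.N.module_axioms)
  have SD_simps: "carrier ?SD = MR \<times> carrier T" "\<zero>\<^bsub>?SD\<^esub> = (\<zero>\<^bsub>DR\<^esub>, \<zero>\<^bsub>T\<^esub>)"
    "\<And>v w. v \<oplus>\<^bsub>?SD\<^esub> w = (fst v \<oplus>\<^bsub>DR\<^esub> fst w, snd v \<oplus>\<^bsub>T\<^esub> snd w)"
    "\<And>c v. c \<odot>\<^bsub>?SD\<^esub> v = (c \<odot>\<^bsub>DR\<^esub> fst v, c \<odot>\<^bsub>RL\<^esub> snd v)"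
    by (simp_all add: semidirect_def Let_def direct_sum_def base_change_simps)
  have phi': "phi' K R L \<phi> l = (anchor (\<one> \<otimes>\<^sub>T l), \<one> \<otimes>\<^sub>T l)" if "l \<in> carrier L" for l
    using that by (simp add: phi'_def anchor_pure phi_closed)
  have gens: "phi' K R L \<phi> ` carrier L \<subseteq> ?graph"
    by (auto simp: phi' pure_closed)
  have mem_graph: "v \<in> ?graph \<longleftrightarrow> snd v \<in> carrier T \<and> fst v = anchor (snd v)" for v
    by (cases v) (auto simp: image_iff)
  have graph: "LinearCombinations.submodule R ?graph ?SD"
  proof
    show "?graph \<subseteq> carrier ?SD" by (rule subsetI) (use anchor_image in \<open>auto simp: SD_simps\<close>)
    show "\<zero>\<^bsub>?SD\<^esub> \<in> ?graph"
      by (simp add: mem_graph SD_simps anchor_zero)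
    show "v \<oplus>\<^bsub>?SD\<^esub> w \<in> ?graph" if "v \<in> ?graph" "w \<in> ?graph" for v w
      using that by (simp add: mem_graph SD_simps anchor_add)
    show "c \<odot>\<^bsub>?SD\<^esub> v \<in> ?graph" if "c \<in> carrier R" "v \<in> ?graph" for c v
      using that by (simp add: mem_graph SD_simps anchor_smult)
  qed
  have gens_closed: "phi' K R L \<phi> ` carrier L \<subseteq> carrier ?SD"
    by (rule subset_trans[OF gens LinearCombinations.submodule.subset[OF graph]])
  interpret sp: LinearCombinations.submodule R ?span ?SD
    by (rule SD.span_is_submodule[OF gens_closed])
  have "(anchor A, A) \<in> ?span" if "A \<in> carrier T" for A
    using that
  proof (induction rule: tensor_induct)
    case zero
    then show ?case using sp.zero_closed by (simp add: SD_simps anchor_zero)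
  next
    case (pure r l)
    have "phi' K R L \<phi> l \<in> ?span"
      using SD.in_own_span[OF gens_closed] pure by auto
    then have "r \<odot>\<^bsub>?SD\<^esub> phi' K R L \<phi> l \<in> ?span"
      using pure by (intro sp.smult_closed)
    then show ?case
      using pure by (simp add: phi' SD_simps base_change_smult_pure pure_closed flip: anchor_smult)
  next
    case (add A B)
    then have "(anchor A, A) \<oplus>\<^bsub>?SD\<^esub> (anchor B, B) \<in> ?span"
      by (intro sp.m_closed)
    then show ?case using add by (simp add: SD_simps anchor_add)
  qed
  moreover have "?span \<subseteq> ?graph"
    by (rule SD.span_is_subset[OF gens graph])
  ultimately show ?thesis by blast
qed

text \<open>A pair (0, A) lies on the graph exactly when F A = 0.\<close>

lemma L_tilde_eq_ker: "L_tilde K R L \<phi> = anchor.ker"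
  unfolding L_tilde_def span_phi'_eq_graph anchor.ker_def
  by (auto simp: base_change_simps image_iff)

lemma L_tilde_lie_subalgebra: "lie_subalgebra R (L_tilde K R L \<phi>) RL"
proof -
  interpret RL: lie_algebra R RL by (rule base_change_lie_algebra)
  have "subspace R (L_tilde K R L \<phi>) RL"
    using anchor.ker_is_submodule RL.vectorspace_axioms by (simp add: subspace_def L_tilde_eq_ker)
  moreover have "bracket RL A B \<in> L_tilde K R L \<phi>"
    if "A \<in> L_tilde K R L \<phi>" "B \<in> L_tilde K R L \<phi>" for A B
  proof -
    have AB: "A \<in> carrier T" "B \<in> carrier T" "anchor A = \<zero>\<^bsub>DR\<^esub>" "anchor B = \<zero>\<^bsub>DR\<^esub>"
      using that by (auto simp: L_tilde_eq_ker anchor.ker_def base_change_simps)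
    have D: "anchor (bracket RL A B) \<in> derivations K R"
      using AB by (simp add: anchor_derivation)
    \<comment> \<open>The other four terms of \<open>anchor_bracket\<close> vanish: two are actions
      of the zero derivation, two are composites of zero derivations.\<close>
    have "anchor (bracket RL A B) x = \<zero>" if "x \<in> carrier R" for x
      using anchor_bracket[OF AB(1,2) that] AB that derivationD(2)[OF D that]
      by (simp add: der_action_zero_left anchor_zero) (simp add: Der_simps)
    \<comment> \<open>Derivations are extensional, so vanishing on the carrier gives equality with
      the zero derivation.\<close>
    then have "anchor (bracket RL A B) = \<zero>\<^bsub>DR\<^esub>"
      using derivationD(1)[OF D] by (auto simp: Der_simps intro!: extensionalityI[of _ "carrier R"])
    then show ?thesis
      using AB by (simp add: L_tilde_eq_ker anchor.ker_def base_change_simps)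
  qed
  ultimately show ?thesis
    by (simp add: lie_subalgebra_def base_change_lie_algebra)
qed

end

theorem proposition1:
  fixes K :: "('k, 'm) ring_scheme"
    and R :: "('k, 'r, 'n) module_scheme"
    and L :: "('k, 'l, 'p) module_scheme"
    and \<phi> :: "'l \<Rightarrow> 'r \<Rightarrow> 'r"
    and M :: "('r \<Rightarrow> 'r) set"
    and k :: nat
  assumes "field K"
    and "field R" and "algebra K R"
    and "lie_algebra K L"
    and "\<phi> \<in> lie_hom K L (restrict_scalars R (Der K R))"
    and "inj_on \<phi> (carrier L)"
    and "M = R_span_image K R L \<phi>"
    and "has_dim R ((Der K R)\<lparr>carrier := M\<rparr>) k"
  shows "lie_subalgebra R (L_tilde K R L \<phi>) (lie_base_change K R L) \<and>
         has_codim R (lie_base_change K R L) (L_tilde K R L \<phi>) k"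
proof -
  interpret R: field R by fact
  interpret alg: algebra K R by fact
  interpret lie: lie_algebra K L by fact
  interpret lie_extension K R L \<phi> by unfold_locales fact
  \<comment> \<open>The anchor maps onto M, so its kernel has the dimension k of M as
    codimension.\<close>
  have "has_codim R (lie_base_change K R L) anchor.ker k"
    using assms(2,7,8)
    by (intro has_codim_ker[OF anchor.mod_hom_axioms]) (simp_all add: base_change_simps anchor_image)
  then show ?thesis
    using L_tilde_lie_subalgebra by (simp add: L_tilde_eq_ker)
qed

end
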